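(* For every $k\ge 3$ and $c\ge 0.7\cdot 2^k$ there exists $\varepsilon>0$ such that the following holds. Let $F$ be drawn from $\mathcal{F}(k,n,cn)$, $L:=(1+\varepsilon)^n$, and let $\mathcal{F}^L_{\mathsf{sLB}}(F)$ be the CNF encoding that $F$ has no resolution refutation with at most $L$ clauses. With probability tending to $1$ as $n\to\infty$ over $F$, $\mathcal{F}^L_{\mathsf{sLB}}(F)$ admits a $\gamma$-random resolution refutation of width $\mathrm{poly}(n)$ with $\gamma=2^{-\Omega(n)}$.
   Context: $\mathcal{F}(k,n,m)$: random $k$-CNF over $n$ variables with $m$ clauses chosen independently and uniformly among the $\binom{n}{k}2^k$ ordinary width-$k$ clauses. $\mathcal{F}^L_{\mathsf{sLB}}(F)$: CNF whose variables encode in binary a purported resolution refutation $C_0,\dots,C_{L-1}$ of $F$ (each node: a clause over the $n$ variables, a tag resolution/weakening, indices of earlier predecessors, resolved variable; $O(n+\log L)$ bits per node), containing, for each possible invalid node, clauses (from the negation of the verifying decision tree) asserting that node is valid, and asserting the last clause is empty; it has width $O(n+\log L)$. An $\varepsilon$-random resolution refutation of an unsatisfiable CNF $H$ is a distribution $\mathcal{D}$ over pairs $(\Pi,B)$, where $B$ is a CNF over the variables of $H$, $\Pi$ is a resolution refutation of $H\wedge B$, and for every assignment $x$, $\Pr_{(\Pi,B)\sim\mathcal{D}}[B(x)=1]\ge 1-\varepsilon$. Its width is the maximum width of $\Pi$ in the support. *)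

theory Defs
  imports "HOL-Probability.Probability_Mass_Function"
begin

text \<open>A literal over variables of type 'v is a pair (x, b): (x, True) is the positive
literal x, (x, False) is the negated literal. A clause is a set of literals, a CNF a set of clauses.\<close>

type_synonym 'v clause = "('v \<times> bool) set"
type_synonym 'v cnf = "'v clause set"

definition sat_clause :: "('v \<Rightarrow> bool) \<Rightarrow> 'v clause \<Rightarrow> bool" where
  "sat_clause \<alpha> C \<longleftrightarrow> (\<exists>(x, b)\<in>C. \<alpha> x = b)"

definition sat_cnf :: "('v \<Rightarrow> bool) \<Rightarrow> 'v cnf \<Rightarrow> bool" where
  "sat_cnf \<alpha> H \<longleftrightarrow> (\<forall>C\<in>H. sat_clause \<alpha> C)"

definition cnf_vars :: "'v cnf \<Rightarrow> 'v set" where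
  "cnf_vars H = fst ` (\<Union>H)"

definition is_resolvent :: "'v clause \<Rightarrow> 'v clause \<Rightarrow> 'v \<Rightarrow> 'v clause \<Rightarrow> bool" where
  "is_resolvent A B x R \<longleftrightarrow>
     (x, True) \<in> A \<and> (x, False) \<in> B \<and> R = (A - {(x, True)}) \<union> (B - {(x, False)})"

definition is_refutation :: "'v cnf \<Rightarrow> 'v clause list \<Rightarrow> bool" where
  "is_refutation H P \<longleftrightarrow> P \<noteq> [] \<and> last P = {} \<and>
     (\<forall>i<length P. P ! i \<in> H
        \<or> (\<exists>j<i. P ! j \<subseteq> P ! i)
        \<or> (\<exists>j<i. \<exists>l<i. \<exists>x. is_resolvent (P ! j) (P ! l) x (P ! i)))"

definition ref_width :: "'v clause list \<Rightarrow> nat" where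
  "ref_width P = Max (insert 0 (card ` set P))"

definition random_refutation ::
  "('v clause list \<times> 'v cnf) pmf \<Rightarrow> 'v cnf \<Rightarrow> real \<Rightarrow> real \<Rightarrow> bool" where
  "random_refutation D H eps w \<longleftrightarrow>
     (\<forall>(P, B)\<in>set_pmf D. (\<forall>C\<in>B. fst ` C \<subseteq> cnf_vars H) \<and> is_refutation (H \<union> B) P
                          \<and> real (ref_width P) \<le> w) \<and>
     (\<forall>\<alpha>. measure_pmf.prob D {(P, B). sat_cnf \<alpha> B} \<ge> 1 - eps)"

definition ordinary_clauses :: "nat \<Rightarrow> nat \<Rightarrow> nat cnf" where
  "ordinary_clauses k n = {C. C \<subseteq> {..<n} \<times> UNIV \<and> card C = k \<and> card (fst ` C) = k}"

definition random_kcnf :: "nat \<Rightarrow> nat \<Rightarrow> nat \<Rightarrow> nat clause list pmf" where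
  "random_kcnf k n m = replicate_pmf m (pmf_of_set (ordinary_clauses k n))"

text \<open>Variables of the encoding of a purported refutation C_0 .. C_(L-1) of F:
  CB i v b : literal (v,b) occurs in C_i (v < n);
  TG i     : tag of node i (True = resolution, False = weakening);
  J1 i t, J2 i t : t-th bit of the indices of the two predecessors of node i;
  RV i t   : t-th bit of the resolved variable of node i.\<close>

datatype evar = CB nat nat bool | TG nat | J1 nat nat | J2 nat nat | RV nat nat

definition bits_for :: "nat \<Rightarrow> nat" where
  "bits_for m = (LEAST b. m \<le> 2 ^ b)"

definition bin_val :: "(nat \<Rightarrow> bool) \<Rightarrow> nat \<Rightarrow> nat" where
  "bin_val f b = (\<Sum>t<b. if f t then 2 ^ t else 0)"

definition enc_clause :: "nat \<Rightarrow> (evar \<Rightarrow> bool) \<Rightarrow> nat \<Rightarrow> nat clause" where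
  "enc_clause n \<alpha> i = {(v, b). v < n \<and> \<alpha> (CB i v b)}"

definition enc_j1 :: "nat \<Rightarrow> (evar \<Rightarrow> bool) \<Rightarrow> nat \<Rightarrow> nat" where
  "enc_j1 L \<alpha> i = bin_val (\<lambda>t. \<alpha> (J1 i t)) (bits_for L)"

definition enc_j2 :: "nat \<Rightarrow> (evar \<Rightarrow> bool) \<Rightarrow> nat \<Rightarrow> nat" where
  "enc_j2 L \<alpha> i = bin_val (\<lambda>t. \<alpha> (J2 i t)) (bits_for L)"

definition enc_rv :: "nat \<Rightarrow> (evar \<Rightarrow> bool) \<Rightarrow> nat \<Rightarrow> nat" where
  "enc_rv n \<alpha> i = bin_val (\<lambda>t. \<alpha> (RV i t)) (bits_for n)"

definition clause_bits :: "nat \<Rightarrow> nat \<Rightarrow> evar set" where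
  "clause_bits n i = {CB i v b | v b. v < n}"

definition own_bits :: "nat \<Rightarrow> nat \<Rightarrow> nat \<Rightarrow> evar set" where
  "own_bits n L i = clause_bits n i \<union> {TG i} \<union> {J1 i t | t. t < bits_for L}
     \<union> {J2 i t | t. t < bits_for L} \<union> {RV i t | t. t < bits_for n}"

text \<open>Validity of node i (the function computed by the verifying decision tree).\<close>

definition node_valid :: "nat clause list \<Rightarrow> nat \<Rightarrow> nat \<Rightarrow> (evar \<Rightarrow> bool) \<Rightarrow> nat \<Rightarrow> bool" where
  "node_valid F n L \<alpha> i =
    (let C = enc_clause n \<alpha>; j1 = enc_j1 L \<alpha> i; j2 = enc_j2 L \<alpha> i; v = enc_rv n \<alpha> i in
     if \<alpha> (TG i)
     then j1 < i \<and> j2 < i \<and> v < n \<and> is_resolvent (C j1) (C j2) v (C i)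
     else (\<exists>D\<in>set F. D \<subseteq> C i) \<or> (j1 < i \<and> C j1 \<subseteq> C i))"

text \<open>Variables queried by the verifying decision tree for node i: first all bits of node i,
then (depending on those) the clause bits of the predecessors that have to be inspected.\<close>

definition node_queries :: "nat clause list \<Rightarrow> nat \<Rightarrow> nat \<Rightarrow> (evar \<Rightarrow> bool) \<Rightarrow> nat \<Rightarrow> evar set" where
  "node_queries F n L \<alpha> i =
    (let C = enc_clause n \<alpha>; j1 = enc_j1 L \<alpha> i; j2 = enc_j2 L \<alpha> i; v = enc_rv n \<alpha> i in
     own_bits n L i \<union>
     (if \<alpha> (TG i)
      then (if j1 < i \<and> j2 < i \<and> v < n then clause_bits n j1 \<union> clause_bits n j2 else {})
      else (if (\<exists>D\<in>set F. D \<subseteq> C i) then {} else if j1 < i then clause_bits n j1 else {})))"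

definition neg_path :: "(evar \<Rightarrow> bool) \<Rightarrow> evar set \<Rightarrow> evar clause" where
  "neg_path \<alpha> Q = {(x, \<not> \<alpha> x) | x. x \<in> Q}"

text \<open>F^L_sLB(F): for every node i < L, the negations of the rejecting paths of its verifying
decision tree, plus unit clauses asserting that the last clause C_(L-1) is empty.\<close>

definition sLB :: "nat clause list \<Rightarrow> nat \<Rightarrow> nat \<Rightarrow> evar cnf" where
  "sLB F n L =
     {neg_path \<alpha> (node_queries F n L \<alpha> i) | \<alpha> i. i < L \<and> \<not> node_valid F n L \<alpha> i}
     \<union> {{(CB (L - 1) v b, False)} | v b. v < n}"

end

theory Submission
  imports Defs
begin

text \<open>For random \<open>F\<close>, every small set of clauses has a large boundary (variables occurring in exactly
  one of its clauses). Restrict \<open>F\<close> by a random partial assignment \<open>\<rho>\<close> to a linear number of variables,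
  chosen so that clauses containing different ones of them are disjoint; then small subsets of \<open>F\<close> stay satisfiable after every such
  restriction. The auxiliary CNF \<open>B\<close> says that every wide clause of the purported refutation is
  satisfied by \<open>\<rho>\<close>, which by a union bound fails with exponentially small probability. Given \<open>B\<close>,
  walk down the purported refutation from the empty clause, always moving to a clause that no
  small subset of \<open>F\<close> entails under \<open>\<rho>\<close>; such a clause is never an axiom, and the walk can only be
  stuck at a clause of intermediate complexity, which is wide and not satisfied by \<open>\<rho>\<close>,
  contradicting \<open>B\<close>. The walk remembers one node at a time, hence the linear width.\<close>

section \<open>Resolution derivations of bounded width\<close>

text \<open>The restriction faces two opposite demands. It must fix linearly many variables, since a
  clause of linear width may be missed only with a probability that survives a union bound over all
  \<open>L\<close> nodes. But an arbitrary set of that size may contain all variables of some clause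
  of \<open>F\<close>, and falsifying a single clause makes even the empty clause easy. Keeping the
  chosen variables free of conflicts reconciles the two: a clause then contains at most one of them,
  and a set of clauses whose boundary is at least 3/4 of its size cannot lose all of that boundary.
  Moreover each choice should rule out only constantly many later ones, although degrees in
  \<open>F\<close> are not bounded by a constant; therefore the surroundings of high-degree
  variables are discarded in advance. Finally, \<open>B\<close> depends on \<open>\<rho>\<close>
  alone while the error is measured for each fixed assignment. The clauses of the purported
  refutation are then fixed before \<open>\<rho>\<close> is drawn, so each of them can be treated
  separately.\<close>

definition inference_ok :: "'v cnf \<Rightarrow> 'v clause list \<Rightarrow> nat \<Rightarrow> bool" where
  "inference_ok H P i \<longleftrightarrow> P ! i \<in> H \<or> (\<exists>j<i. P ! j \<subseteq> P ! i)
     \<or> (\<exists>j<i. \<exists>l<i. \<exists>x. is_resolvent (P ! j) (P ! l) x (P ! i))"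

lemma inference_ok_append1:
  assumes "inference_ok H P i" "i < length P"
  shows "inference_ok H (P @ Q) i"
proof -
  have "\<And>j. j \<le> i \<Longrightarrow> (P @ Q) ! j = P ! j"
    using assms(2) by (simp add: nth_append)
  then show ?thesis
    using assms(1) unfolding inference_ok_def by (metis less_imp_le order_refl)
qed

lemma inference_ok_append2:
  assumes "inference_ok H Q i"
  shows "inference_ok H (P @ Q) (length P + i)"
proof -
  have nth: "\<And>j. (P @ Q) ! (length P + j) = Q ! j"
    by (simp add: nth_append)
  from assms consider "Q ! i \<in> H" | j where "j < i" "Q ! j \<subseteq> Q ! i"
    | j l x where "j < i" "l < i" "is_resolvent (Q ! j) (Q ! l) x (Q ! i)"
    unfolding inference_ok_def by blast
  then show ?thesis
  proof cases
    case 1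
    then show ?thesis by (simp add: inference_ok_def nth)
  next
    case 2
    then show ?thesis unfolding inference_ok_def nth
      by (metis nth nat_add_left_cancel_less)
  next
    case 3
    then show ?thesis unfolding inference_ok_def nth
      by (metis nth nat_add_left_cancel_less)
  qed
qed

text \<open>Only width matters, so a derivation may be a tree: lists for the premises are
  concatenated, and repeated lines cost nothing. Every rule carries the bound because intermediate
  clauses must obey it too.\<close>

inductive derivable :: "'v cnf \<Rightarrow> nat \<Rightarrow> 'v clause \<Rightarrow> bool" for H W where
  axiom: "C \<in> H \<Longrightarrow> card C \<le> W \<Longrightarrow> derivable H W C"
| weaken: "derivable H W A \<Longrightarrow> A \<subseteq> C \<Longrightarrow> card C \<le> W \<Longrightarrow> derivable H W C"
| resolve: "derivable H W A \<Longrightarrow> derivable H W B \<Longrightarrow> is_resolvent A B x C \<Longrightarrow> card C \<le> W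
    \<Longrightarrow> derivable H W C"

lemma derivable_imp_list:
  assumes "derivable H W C"
  shows "\<exists>P. P \<noteq> [] \<and> last P = C \<and> (\<forall>i<length P. inference_ok H P i \<and> card (P ! i) \<le> W)"
  using assms
proof induction
  case (axiom C)
  then show ?case
    by (intro exI[of _ "[C]"]) (auto simp: inference_ok_def)
next
  case (weaken A C)
  then obtain P where P: "P \<noteq> []" "last P = A"
    "\<And>i. i < length P \<Longrightarrow> inference_ok H P i \<and> card (P ! i) \<le> W" by blast
  have new: "inference_ok H (P @ [C]) (length P)"
    unfolding inference_ok_def
    by (rule disjI2, rule disjI1, rule exI[of _ "length P - 1"])
       (use P weaken.hyps in \<open>auto simp: nth_append last_conv_nth\<close>)
  show ?case
  proof (intro exI[of _ "P @ [C]"] conjI allI impI)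
    fix i assume i: "i < length (P @ [C])"
    then show "inference_ok H (P @ [C]) i"
      using P(3)[of i] new inference_ok_append1[of H P i "[C]"] by (cases "i = length P") auto
    show "card ((P @ [C]) ! i) \<le> W"
      using i P(3) weaken.hyps by (cases "i = length P") (auto simp: nth_append)
  qed auto
next
  case (resolve A B x C)
  then obtain P Q where P: "P \<noteq> []" "last P = A"
    "\<And>i. i < length P \<Longrightarrow> inference_ok H P i \<and> card (P ! i) \<le> W"
    and Q: "Q \<noteq> []" "last Q = B"
    "\<And>i. i < length Q \<Longrightarrow> inference_ok H Q i \<and> card (Q ! i) \<le> W" by blast
  define R where "R = P @ Q @ [C]"
  have nA: "R ! (length P - 1) = A" and nB: "R ! (length P + (length Q - 1)) = B"
    and nC: "R ! (length P + length Q) = C"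
    using P(1,2) Q(1,2) by (auto simp: R_def nth_append last_conv_nth)
  have lt: "length P - 1 < length P + length Q" "length P + (length Q - 1) < length P + length Q"
    using P(1) Q(1) by (simp_all add: less_imp_diff_less)
  have new: "inference_ok H R (length P + length Q)"
    unfolding inference_ok_def nC
    using lt resolve.hyps(3)[folded nA nB] by blast
  have "inference_ok H R i \<and> card (R ! i) \<le> W" if "i < length R" for i
  proof -
    have i: "i < length P + length Q + 1" using that by (simp add: R_def)
    consider "i < length P" | l where "i = length P + l" "l < length Q" | "i = length P + length Q"
    proof (cases "i < length P")
      case False
      then obtain l where "i = length P + l" using le_Suc_ex[of "length P" i] by auto
      then show thesis using that i by (cases "l < length Q") auto
    qed (use that in blast)
    then show ?thesis
    proof cases
      case 1
      then show ?thesis using P(3)[of i] inference_ok_append1[of H P i "Q @ [C]"]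
        by (auto simp: R_def nth_append)
    next
      case 2
      then show ?thesis
        using Q(3)[of l] inference_ok_append2[OF inference_ok_append1[of H Q l "[C]"], of P]
        by (auto simp: R_def nth_append)
    next
      case 3
      then show ?thesis using new nC resolve.hyps by simp
    qed
  qed
  then show ?case by (intro exI[of _ R]) (auto simp: R_def)
qed

lemma derivable_empty_imp_refutation:
  assumes "derivable H W {}"
  shows "\<exists>P. is_refutation H P \<and> ref_width P \<le> W"
proof -
  obtain P where P: "P \<noteq> []" "last P = {}"
    "\<And>i. i < length P \<Longrightarrow> inference_ok H P i \<and> card (P ! i) \<le> W"
    using derivable_imp_list[OF assms] by blast
  have "is_refutation H P"
    using P unfolding is_refutation_def inference_ok_def by blast
  moreover have "ref_width P \<le> W"
    unfolding ref_width_def using P(3) by (auto simp: in_set_conv_nth)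
  ultimately show ?thesis by blast
qed

section \<open>Paths of a decision tree as clauses\<close>

lemma card_neg_path: "card (neg_path \<alpha> Q) = card Q"
proof -
  have "neg_path \<alpha> Q = (\<lambda>x. (x, \<not> \<alpha> x)) ` Q" by (auto simp: neg_path_def)
  moreover have "inj_on (\<lambda>x. (x, \<not> \<alpha> x)) Q" by (auto intro: inj_onI)
  ultimately show ?thesis by (simp add: card_image)
qed

lemma neg_path_mono: "Q \<subseteq> R \<Longrightarrow> neg_path \<alpha> Q \<subseteq> neg_path \<alpha> R"
  by (auto simp: neg_path_def)

text \<open>A decision tree querying \<open>Q\<close> whose leaves are all derivable, read as a resolution
  derivation from the leaves to the root.\<close>

lemma derivable_branch:
  assumes "finite Q" "finite Q0" "card (Q0 \<union> Q) \<le> W"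
    and "\<And>\<alpha>. (\<And>x. x \<in> Q0 \<Longrightarrow> \<alpha> x = \<beta> x) \<Longrightarrow> derivable H W (neg_path \<alpha> (Q0 \<union> Q))"
  shows "derivable H W (neg_path \<beta> Q0)"
  using assms
proof (induction Q arbitrary: Q0 \<beta> rule: finite_induct)
  case empty
  then show ?case by simp
next
  case (insert x Q)
  show ?case
  proof (cases "x \<in> Q0")
    case True
    then have "Q0 \<union> insert x Q = Q0 \<union> Q" by auto
    then show ?thesis using insert by metis
  next
    case False
    have eq: "insert x Q0 \<union> Q = Q0 \<union> insert x Q" by auto
    have br: "derivable H W (neg_path (\<beta>(x := b)) (insert x Q0))" for b
    proof (rule insert.IH)
      fix \<alpha> assume \<alpha>: "\<And>y. y \<in> insert x Q0 \<Longrightarrow> \<alpha> y = (\<beta>(x := b)) y"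
      have "\<And>y. y \<in> Q0 \<Longrightarrow> \<alpha> y = \<beta> y" using \<alpha> False by (metis fun_upd_other insertCI)
      then show "derivable H W (neg_path \<alpha> (insert x Q0 \<union> Q))"
        unfolding eq by (rule insert.prems(3))
    qed (use insert.prems eq in auto)
    have np: "neg_path (\<beta>(x := b)) (insert x Q0) = insert (x, \<not> b) (neg_path \<beta> Q0)" for b
      using False by (auto simp: neg_path_def)
    have notin: "(x, b) \<notin> neg_path \<beta> Q0" for b
      using False by (auto simp: neg_path_def)
    \<comment> \<open>\<open>neg_path\<close> stores negated answers, so the branch
      \<open>x := False\<close> supplies the positive pivot literal and is the first
      premise.\<close>
    have res: "is_resolvent (neg_path (\<beta>(x := False)) (insert x Q0))
        (neg_path (\<beta>(x := True)) (insert x Q0)) x (neg_path \<beta> Q0)"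
      unfolding is_resolvent_def np using notin by auto
    have "card Q0 \<le> W"
      using insert.prems insert.hyps by (meson card_mono finite_UnI finite_insert le_trans sup_ge1)
    then show ?thesis
      using derivable.resolve[OF br br res] by (simp add: card_neg_path)
  qed
qed

section \<open>Number of variables read when a node is checked\<close>

lemma card_clause_bits: "finite (clause_bits n i) \<and> card (clause_bits n i) \<le> 2 * n"
proof -
  have "clause_bits n i = (\<lambda>(v, b). CB i v b) ` ({..<n} \<times> UNIV)"
    by (auto simp: clause_bits_def)
  moreover have "card ({..<n} \<times> (UNIV :: bool set)) = 2 * n"
    by (simp add: card_cartesian_product)
  ultimately show ?thesis
    using card_image_le[of "{..<n} \<times> (UNIV :: bool set)" "\<lambda>(v, b). CB i v b"] by simp
qed

lemma bits_for_le: "m \<le> 2 ^ b \<Longrightarrow> bits_for m \<le> b"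
  unfolding bits_for_def by (rule Least_le)

lemma card_own_bits:
  assumes "L \<le> 2 ^ n"
  shows "finite (own_bits n L i) \<and> card (own_bits n L i) \<le> 5 * n + 1"
proof -
  have im: "finite {f t | t. t < m} \<and> card {f t | t. t < m} \<le> m" for f :: "nat \<Rightarrow> evar" and m
  proof -
    have "{f t | t. t < m} = f ` {..<m}" by auto
    then show ?thesis using card_image_le[of "{..<m}" f] by simp
  qed
  have bL: "bits_for L \<le> n" by (rule bits_for_le[OF assms])
  have bn: "bits_for n \<le> n" by (rule bits_for_le) (simp add: less_imp_le)
  let ?a = "clause_bits n i" and ?b = "{TG i}" and ?c = "{J1 i t | t. t < bits_for L}"
    and ?d = "{J2 i t | t. t < bits_for L}" and ?e = "{RV i t | t. t < bits_for n}"
  have "card (?a \<union> ?b \<union> ?c \<union> ?d \<union> ?e) \<le> card ?a + card ?b + card ?c + card ?d + card ?e"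
    by (meson add_le_mono1 card_Un_le order_trans)
  also have "\<dots> \<le> 2 * n + 1 + n + n + n"
    using card_clause_bits[of n i] im[of "J1 i" "bits_for L"] im[of "J2 i" "bits_for L"]
      im[of "RV i" "bits_for n"] bL bn by (intro add_mono) auto
  finally show ?thesis
    unfolding own_bits_def
    using card_clause_bits[of n i] im[of "J1 i" "bits_for L"] im[of "J2 i" "bits_for L"]
      im[of "RV i" "bits_for n"] by auto
qed

text \<open>A node has 2n clause bits, a tag, and three fields of at most n bits each; the two
  predecessors add 2n clause bits each. This is the origin of the width 9n + 1.\<close>

lemma card_node_queries:
  assumes "L \<le> 2 ^ n"
  shows "finite (node_queries F n L \<alpha> i) \<and> card (node_queries F n L \<alpha> i) \<le> 9 * n + 1"
proof -
  let ?A = "clause_bits n (enc_j1 L \<alpha> i)" and ?B = "clause_bits n (enc_j2 L \<alpha> i)"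
  have sub: "node_queries F n L \<alpha> i \<subseteq> own_bits n L i \<union> (?A \<union> ?B)"
    unfolding node_queries_def Let_def by auto
  have fin: "finite (own_bits n L i \<union> (?A \<union> ?B))"
    using card_own_bits[OF assms] card_clause_bits by blast
  have "card (own_bits n L i \<union> (?A \<union> ?B)) \<le> (5 * n + 1) + (2 * n + 2 * n)"
    by (meson add_mono card_Un_le card_clause_bits card_own_bits[OF assms] le_trans)
  then show ?thesis
    using finite_subset[OF sub fin] card_mono[OF fin sub] by linarith
qed

section \<open>Locality of the decoding, and the walk through the purported refutation\<close>

lemma enc_clause_cong:
  "(\<And>x. x \<in> clause_bits n i \<Longrightarrow> \<alpha> x = \<beta> x) \<Longrightarrow> enc_clause n \<alpha> i = enc_clause n \<beta> i"
  unfolding enc_clause_def clause_bits_def by blast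

text \<open>The own bits decide which predecessors are inspected. Once they are fixed, the remaining
  queries form a fixed set, as \<open>derivable_branch\<close> demands.\<close>

lemma node_queries_cong:
  assumes "\<And>x. x \<in> own_bits n L i \<Longrightarrow> \<alpha> x = \<beta> x"
  shows "node_queries F n L \<alpha> i = node_queries F n L \<beta> i"
proof -
  have "enc_clause n \<alpha> i = enc_clause n \<beta> i"
    by (rule enc_clause_cong) (use assms in \<open>auto simp: own_bits_def\<close>)
  moreover have "enc_j1 L \<alpha> i = enc_j1 L \<beta> i" "enc_j2 L \<alpha> i = enc_j2 L \<beta> i"
    "enc_rv n \<alpha> i = enc_rv n \<beta> i"
    unfolding enc_j1_def enc_j2_def enc_rv_def bin_val_def
    by (intro sum.cong refl, use assms in \<open>auto simp: own_bits_def\<close>)+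
  moreover have "\<alpha> (TG i) = \<beta> (TG i)"
    using assms by (auto simp: own_bits_def)
  ultimately show ?thesis unfolding node_queries_def Let_def by simp
qed

text \<open>Any predicate on the decoded clause of a node becomes a CNF by excluding the bit
  patterns that satisfy it. Each clause mentions the clause bits of one node only, so its width is
  at most 2n.\<close>

definition wide_axioms :: "nat \<Rightarrow> nat \<Rightarrow> (nat clause \<Rightarrow> bool) \<Rightarrow> evar cnf" where
  "wide_axioms n L Wd = {neg_path \<alpha> (clause_bits n j) | \<alpha> j. j < L \<and> Wd (enc_clause n \<alpha> j)}"

text \<open>\<open>Hd\<close> (hard clauses) is propagated from the last node of the purported refutation to some
  predecessor until a clause excluded by \<open>Wd\<close> is met.\<close>

lemma sLB_derivable_empty:
  assumes "1 \<le> L" "L \<le> 2 ^ n" "9 * n + 1 \<le> W"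
    and empty: "Hd {}"
    and ax: "\<And>C D. Hd C \<Longrightarrow> D \<in> set F \<Longrightarrow> \<not> D \<subseteq> C"
    and mono: "\<And>C C'. Hd C \<Longrightarrow> C' \<subseteq> C \<Longrightarrow> Hd C'"
    and res: "\<And>A B x R. \<lbrakk>Hd R; is_resolvent A B x R; A \<subseteq> {..<n} \<times> UNIV; B \<subseteq> {..<n} \<times> UNIV\<rbrakk>
       \<Longrightarrow> Hd A \<or> Hd B \<or> Wd A \<or> Wd B"
  shows "derivable (sLB F n L \<union> wide_axioms n L Wd) W {}"
proof -
  define H where "H = sLB F n L \<union> wide_axioms n L Wd"
  have enc_sub: "enc_clause n \<alpha> j \<subseteq> {..<n} \<times> UNIV" for \<alpha> j
    by (auto simp: enc_clause_def)
  have cb: "card (clause_bits n j) \<le> W" for j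
    using card_clause_bits[of n j] assms(3) by linarith
  have wide: "derivable H W (neg_path \<alpha> (clause_bits n j))"
    if "j < L" "Wd (enc_clause n \<alpha> j)" for \<alpha> j
    by (rule derivable.axiom)
       (use that cb in \<open>auto simp: H_def wide_axioms_def card_neg_path\<close>)
  \<comment> \<open>The derived clause denies that node \<open>i\<close> carries the hard clause
    decoded from \<open>\<alpha>\<close>. Induction on \<open>i\<close> applies because predecessors
    have smaller indices.\<close>
  have claim: "derivable H W (neg_path \<alpha> (clause_bits n i))"
    if "i < L" "Hd (enc_clause n \<alpha> i)" for i \<alpha>
    using that
  proof (induction i arbitrary: \<alpha> rule: less_induct)
    case (less i \<alpha>)
    have ow: "finite (own_bits n L i)" "card (own_bits n L i) \<le> W"
      using card_own_bits[OF assms(2), of i] assms(3) by auto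
    have cown: "clause_bits n i \<union> own_bits n L i = own_bits n L i"
      by (auto simp: own_bits_def)
    show ?case
    \<comment> \<open>Two rounds of branching: the queries beyond the own bits are known only after
      the first round.\<close>
    proof (rule derivable_branch[where Q = "own_bits n L i"], goal_cases)
      case (4 \<beta>)
      have encb: "enc_clause n \<beta> i = enc_clause n \<alpha> i"
        by (rule enc_clause_cong) (use 4 in auto)
      let ?Q = "node_queries F n L \<beta> i"
      have nq: "finite ?Q" "card ?Q \<le> W"
        using card_node_queries[OF assms(2), of F \<beta> i] assms(3) by auto
      have ownQ: "own_bits n L i \<union> ?Q = ?Q" by (auto simp: node_queries_def Let_def)
      show ?case unfolding cown
      proof (rule derivable_branch[where Q = ?Q], goal_cases)
        case (4 \<gamma>)
        have eqQ: "node_queries F n L \<gamma> i = ?Q"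
          by (rule node_queries_cong) (use 4 in auto)
        have encc: "enc_clause n \<gamma> i = enc_clause n \<alpha> i"
          unfolding encb[symmetric] by (rule enc_clause_cong) (use 4 in \<open>auto simp: own_bits_def\<close>)
        have Hdi: "Hd (enc_clause n \<gamma> i)" using encc less.prems by simp
        \<comment> \<open>Read from the root, this weakening is the moment when the walk forgets
          everything but the clause of the predecessor.\<close>
        have child: "derivable H W (neg_path \<gamma> ?Q)"
          if "j < i" "Hd (enc_clause n \<gamma> j) \<or> Wd (enc_clause n \<gamma> j)" "clause_bits n j \<subseteq> ?Q" for j
        proof -
          have "derivable H W (neg_path \<gamma> (clause_bits n j))"
            using that less.IH[of j \<gamma>] wide[of j \<gamma>] less.prems(1) by auto
          then show ?thesis
            by (rule derivable.weaken) (use that nq in \<open>auto simp: card_neg_path neg_path_mono\<close>)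
        qed
        show ?case unfolding ownQ
        proof (cases "node_valid F n L \<gamma> i")
          case False
          show "derivable H W (neg_path \<gamma> ?Q)"
            by (rule derivable.axiom)
               (use False less.prems nq eqQ in \<open>auto simp: H_def sLB_def card_neg_path\<close>)
        next
          case True
          let ?j1 = "enc_j1 L \<gamma> i" and ?j2 = "enc_j2 L \<gamma> i" and ?v = "enc_rv n \<gamma> i"
          show "derivable H W (neg_path \<gamma> ?Q)"
          proof (cases "\<gamma> (TG i)")
            case tg: True
            then have v: "?j1 < i" "?j2 < i" "?v < n"
              "is_resolvent (enc_clause n \<gamma> ?j1) (enc_clause n \<gamma> ?j2) ?v (enc_clause n \<gamma> i)"
              using True by (auto simp: node_valid_def Let_def)
            have sub: "clause_bits n ?j1 \<subseteq> ?Q" "clause_bits n ?j2 \<subseteq> ?Q"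
              unfolding eqQ[symmetric] by (auto simp: node_queries_def Let_def tg v(1-3))
            show ?thesis
              using res[OF Hdi v(4) enc_sub enc_sub] child[OF v(1) _ sub(1)] child[OF v(2) _ sub(2)]
              by blast
          next
            case tg: False
            have noax: "\<not> (\<exists>D\<in>set F. D \<subseteq> enc_clause n \<gamma> i)" using ax[OF Hdi] by blast
            then have v: "?j1 < i" "enc_clause n \<gamma> ?j1 \<subseteq> enc_clause n \<gamma> i"
              using True tg by (auto simp: node_valid_def Let_def)
            have sub: "clause_bits n ?j1 \<subseteq> ?Q"
              unfolding eqQ[symmetric] by (auto simp: node_queries_def Let_def tg v(1) noax)
            show ?thesis using mono[OF Hdi v(2)] child[OF v(1) _ sub] by blast
          qed
        qed
      qed (use nq ow ownQ in auto)
    qed (use ow card_clause_bits cown in auto)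
  qed
  \<comment> \<open>This is the empty clause, whatever the assignment. In the branching below, a set
    bit of the last node contradicts a unit clause of the encoding, and if no bit is set the decoded
    clause is empty, hence hard.\<close>
  have "derivable H W (neg_path undefined {})"
  proof (rule derivable_branch[where Q = "clause_bits n (L - 1)"], goal_cases)
    case (4 \<alpha>)
    show ?case
    proof (cases "\<exists>v b. v < n \<and> \<alpha> (CB (L - 1) v b)")
      case True
      then obtain v b where vb: "v < n" "\<alpha> (CB (L - 1) v b)" by blast
      have "derivable H W {(CB (L - 1) v b, False)}"
        by (rule derivable.axiom) (use vb assms(3) in \<open>auto simp: H_def sLB_def\<close>)
      then show ?thesis
        by (rule derivable.weaken)
           (use vb cb in \<open>auto simp: card_neg_path, auto simp: neg_path_def clause_bits_def\<close>)
    next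
      case False
      then have "enc_clause n \<alpha> (L - 1) = {}" by (auto simp: enc_clause_def)
      then show ?thesis using claim[of "L - 1" \<alpha>] empty assms(1) by simp
    qed
  qed (use card_clause_bits cb in auto)
  then show ?thesis by (simp add: H_def neg_path_def)
qed

text \<open>Auxiliary clauses must use variables of the encoding. With only \<open>TG i\<close> set,
  all decoded clauses are empty and offer no pivot; so node \<open>i\<close> is rejected along a
  path that mentions all its own bits.\<close>

lemma CB_in_vars_sLB:
  assumes "i < L" "v < n"
  shows "CB i v b \<in> cnf_vars (sLB F n L)"
proof -
  define \<alpha> where "\<alpha> = (\<lambda>x. x = TG i)"
  have "enc_clause n \<alpha> j = {}" for j by (auto simp: enc_clause_def \<alpha>_def)
  then have "\<not> node_valid F n L \<alpha> i"
    by (auto simp: node_valid_def Let_def is_resolvent_def \<alpha>_def)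
  then have "neg_path \<alpha> (node_queries F n L \<alpha> i) \<in> sLB F n L"
    using assms by (auto simp: sLB_def)
  moreover have "(CB i v b, \<not> \<alpha> (CB i v b)) \<in> neg_path \<alpha> (node_queries F n L \<alpha> i)"
    using assms by (auto simp: neg_path_def node_queries_def Let_def own_bits_def clause_bits_def)
  ultimately show ?thesis unfolding cnf_vars_def by force
qed

lemma wide_axioms_vars:
  "C \<in> wide_axioms n L Wd \<Longrightarrow> fst ` C \<subseteq> cnf_vars (sLB F n L)"
  by (auto simp: wide_axioms_def neg_path_def clause_bits_def CB_in_vars_sLB)

text \<open>An assignment falsifies \<open>neg_path \<beta> Q\<close> only by agreeing with
  \<open>\<beta>\<close> on \<open>Q\<close>, and then both decode the same clause.\<close>

lemma sat_wide_axioms: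
  assumes "\<And>j. j < L \<Longrightarrow> \<not> Wd (enc_clause n \<alpha> j)"
  shows "sat_cnf \<alpha> (wide_axioms n L Wd)"
  unfolding sat_cnf_def
proof
  fix C assume "C \<in> wide_axioms n L Wd"
  then obtain \<beta> j where C: "C = neg_path \<beta> (clause_bits n j)" "j < L" "Wd (enc_clause n \<beta> j)"
    by (auto simp: wide_axioms_def)
  with assms have "enc_clause n \<alpha> j \<noteq> enc_clause n \<beta> j" by metis
  then obtain x where "x \<in> clause_bits n j" "\<alpha> x \<noteq> \<beta> x" using enc_clause_cong by blast
  then show "sat_clause \<alpha> C" by (force simp: C sat_clause_def neg_path_def)
qed

section \<open>Entailment under a restriction and boundaries\<close>

definition lits_true :: "('v \<Rightarrow> bool) \<Rightarrow> 'v clause \<Rightarrow> bool" where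
  "lits_true \<alpha> \<rho> \<longleftrightarrow> (\<forall>(x, b)\<in>\<rho>. \<alpha> x = b)"

definition entails :: "'v clause \<Rightarrow> 'v cnf \<Rightarrow> 'v clause \<Rightarrow> bool" where
  "entails \<rho> J C \<longleftrightarrow> (\<forall>\<alpha>. lits_true \<alpha> \<rho> \<and> sat_cnf \<alpha> J \<longrightarrow> sat_clause \<alpha> C)"

text \<open>The unique neighbours of \<open>J\<close> in the incidence graph of clauses and
  variables.\<close>

definition boundary :: "'v cnf \<Rightarrow> 'v set" where
  "boundary J = {x. \<exists>!D. D \<in> J \<and> x \<in> fst ` D}"

lemma sat_clause_cong:
  assumes "\<And>x. x \<in> fst ` D \<Longrightarrow> \<alpha> x = \<beta> x"
  shows "sat_clause \<alpha> D \<longleftrightarrow> sat_clause \<beta> D"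
proof -
  have "\<And>x b. (x, b) \<in> D \<Longrightarrow> \<alpha> x = \<beta> x" using assms by force
  then show ?thesis unfolding sat_clause_def by (intro bex_cong) auto
qed

lemma lits_true_cong:
  assumes "\<And>x. x \<in> fst ` \<rho> \<Longrightarrow> \<alpha> x = \<beta> x"
  shows "lits_true \<alpha> \<rho> \<longleftrightarrow> lits_true \<beta> \<rho>"
proof -
  have "\<And>x b. (x, b) \<in> \<rho> \<Longrightarrow> \<alpha> x = \<beta> x" using assms by force
  then show ?thesis unfolding lits_true_def by (intro ball_cong) auto
qed

text \<open>A boundary variable of \<open>J\<close> can be flipped to satisfy its only clause without affecting
  the rest of \<open>J\<close>.\<close>

lemma boundary_flip:
  assumes "x \<in> boundary J" "x \<notin> fst ` \<rho>"
  obtains D where "D \<in> J"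
    and "\<And>\<alpha>. lits_true \<alpha> \<rho> \<Longrightarrow> sat_cnf \<alpha> (J - {D}) \<Longrightarrow>
      \<exists>b. lits_true (\<alpha>(x := b)) \<rho> \<and> sat_cnf (\<alpha>(x := b)) J"
proof -
  from assms(1) obtain D where D: "D \<in> J" "x \<in> fst ` D"
    and uniq: "\<And>E. E \<in> J \<Longrightarrow> x \<in> fst ` E \<Longrightarrow> E = D"
    unfolding boundary_def by blast
  from D(2) obtain b where b: "(x, b) \<in> D" by force
  show thesis
  proof (rule that[OF D(1)], intro exI conjI)
    fix \<alpha> assume \<alpha>: "lits_true \<alpha> \<rho>" "sat_cnf \<alpha> (J - {D})"
    show "lits_true (\<alpha>(x := b)) \<rho>"
    proof -
      have "lits_true (\<alpha>(x := b)) \<rho> \<longleftrightarrow> lits_true \<alpha> \<rho>"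
        by (rule lits_true_cong) (use assms(2) in auto)
      then show ?thesis using \<alpha>(1) by simp
    qed
    show "sat_cnf (\<alpha>(x := b)) J"
      unfolding sat_cnf_def
    proof
      fix E assume E: "E \<in> J"
      show "sat_clause (\<alpha>(x := b)) E"
      proof (cases "E = D")
        case True
        then show ?thesis
          unfolding sat_clause_def using b by (intro bexI[of _ "(x, b)"]) auto
      next
        case False
        then have "x \<notin> fst ` E" using uniq E by blast
        then have "sat_clause (\<alpha>(x := b)) E \<longleftrightarrow> sat_clause \<alpha> E"
          by (intro sat_clause_cong) (metis fun_upd_other)
        then show ?thesis using \<alpha>(2) E False by (auto simp: sat_cnf_def)
      qed
    qed
  qed
qed

text \<open>Dropping the clause that owns \<open>x\<close> admits an assignment falsifying
  \<open>C\<close>. Resetting \<open>x\<close> repairs the dropped clause, so \<open>C\<close> must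
  become true, which forces \<open>x\<close> to occur in it.\<close>

lemma boundary_subset_of_minimal:
  assumes "entails \<rho> J C" "\<And>D. D \<in> J \<Longrightarrow> \<not> entails \<rho> (J - {D}) C"
  shows "boundary J - fst ` \<rho> \<subseteq> fst ` C"
proof
  fix x assume x: "x \<in> boundary J - fst ` \<rho>"
  obtain D where D: "D \<in> J" and flip: "\<And>\<alpha>. lits_true \<alpha> \<rho> \<Longrightarrow> sat_cnf \<alpha> (J - {D}) \<Longrightarrow>
      \<exists>b. lits_true (\<alpha>(x := b)) \<rho> \<and> sat_cnf (\<alpha>(x := b)) J"
    using boundary_flip[of x J \<rho>] x by auto
  obtain \<alpha> where \<alpha>: "lits_true \<alpha> \<rho>" "sat_cnf \<alpha> (J - {D})" "\<not> sat_clause \<alpha> C"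
    using assms(2)[OF D] by (auto simp: entails_def)
  obtain b where "lits_true (\<alpha>(x := b)) \<rho>" "sat_cnf (\<alpha>(x := b)) J"
    using flip[OF \<alpha>(1,2)] by blast
  then have "sat_clause (\<alpha>(x := b)) C" using assms(1) by (auto simp: entails_def)
  moreover have "sat_clause (\<alpha>(x := b)) C \<longleftrightarrow> sat_clause \<alpha> C" if "x \<notin> fst ` C"
    by (rule sat_clause_cong) (use that in auto)
  ultimately show "x \<in> fst ` C" using \<alpha>(3) by blast
qed

text \<open>A clause owning a free boundary variable is removed, the rest is satisfied by induction,
  and the variable is then set in favour of the removed clause.\<close>

lemma satisfiable_of_boundary:
  assumes "finite J" "inj_on fst \<rho>"
    and "\<And>J'. J' \<subseteq> J \<Longrightarrow> J' \<noteq> {} \<Longrightarrow> boundary J' - fst ` \<rho> \<noteq> {}"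
  shows "\<exists>\<alpha>. lits_true \<alpha> \<rho> \<and> sat_cnf \<alpha> J"
  using assms(1,3)
proof (induction J rule: finite_psubset_induct)
  case (psubset J)
  show ?case
  proof (cases "J = {}")
    case True
    \<comment> \<open>Variables outside \<open>\<rho>\<close> default to False; injectivity of
      \<open>fst\<close> says that \<open>\<rho>\<close> has no complementary literals.\<close>
    have "lits_true (\<lambda>x. (x, True) \<in> \<rho>) \<rho>"
      unfolding lits_true_def
    proof clarify
      fix x b assume "(x, b) \<in> \<rho>"
      then show "((x, True) \<in> \<rho>) = b" using inj_onD[OF assms(2), of "(x, b)" "(x, True)"] by auto
    qed
    then show ?thesis using True by (auto simp: sat_cnf_def)
  next
    case False
    then obtain x where x: "x \<in> boundary J" "x \<notin> fst ` \<rho>" using psubset.prems by blast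
    obtain D where D: "D \<in> J" and flip: "\<And>\<alpha>. lits_true \<alpha> \<rho> \<Longrightarrow> sat_cnf \<alpha> (J - {D}) \<Longrightarrow>
        \<exists>b. lits_true (\<alpha>(x := b)) \<rho> \<and> sat_cnf (\<alpha>(x := b)) J"
      using boundary_flip[OF x] by metis
    have "\<exists>\<alpha>. lits_true \<alpha> \<rho> \<and> sat_cnf \<alpha> (J - {D})"
      by (rule psubset.IH) (use D psubset.prems in auto)
    then show ?thesis using flip by blast
  qed
qed

text \<open>The clause complexity of Ben-Sasson and Wigderson, taken under \<open>\<rho>\<close>,
  exceeds \<open>r\<close>.\<close>

definition hard :: "'v cnf \<Rightarrow> 'v clause \<Rightarrow> nat \<Rightarrow> 'v clause \<Rightarrow> bool" where
  "hard F \<rho> r C \<longleftrightarrow> (\<forall>J\<subseteq>F. card J \<le> r \<longrightarrow> \<not> entails \<rho> J C)"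

text \<open>Width is counted in variables, since boundaries consist of variables and a decoded
  clause may contain both literals of one.\<close>

definition wide :: "'v clause \<Rightarrow> nat \<Rightarrow> 'v clause \<Rightarrow> bool" where
  "wide \<rho> w C \<longleftrightarrow> w \<le> card (fst ` C) \<and> C \<inter> \<rho> = {}"

lemma hard_empty:
  assumes "finite F" "inj_on fst \<rho>"
    and "\<And>J. J \<subseteq> F \<Longrightarrow> J \<noteq> {} \<Longrightarrow> card J \<le> r \<Longrightarrow> boundary J - fst ` \<rho> \<noteq> {}"
  shows "hard F \<rho> r {}"
  unfolding hard_def
proof (intro allI impI)
  fix J assume J: "J \<subseteq> F" "card J \<le> r"
  have fin: "finite J" using J assms(1) finite_subset by blast
  have "\<exists>\<alpha>. lits_true \<alpha> \<rho> \<and> sat_cnf \<alpha> J"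
  proof (rule satisfiable_of_boundary[OF fin assms(2)])
    fix J' assume "J' \<subseteq> J" "J' \<noteq> {}"
    then show "boundary J' - fst ` \<rho> \<noteq> {}"
      using J fin by (intro assms(3)) (auto dest: card_mono)
  qed
  then show "\<not> entails \<rho> J {}" by (auto simp: entails_def sat_clause_def)
qed

lemma sat_clause_mono: "sat_clause \<alpha> C \<Longrightarrow> C \<subseteq> D \<Longrightarrow> sat_clause \<alpha> D"
  by (auto simp: sat_clause_def)

lemma hard_no_axiom:
  assumes "hard F \<rho> r C" "D \<in> F" "1 \<le> r"
  shows "\<not> D \<subseteq> C"
proof
  assume "D \<subseteq> C"
  then have "entails \<rho> {D} C" by (auto simp: entails_def sat_cnf_def intro: sat_clause_mono)
  then show False using assms unfolding hard_def by (auto dest: spec[of _ "{D}"])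
qed

lemma hard_mono: "hard F \<rho> r C \<Longrightarrow> C' \<subseteq> C \<Longrightarrow> hard F \<rho> r C'"
  unfolding hard_def entails_def using sat_clause_mono by blast

lemma minimal_entails:
  assumes "finite F" "\<not> hard F \<rho> r C"
  obtains J where "J \<subseteq> F" "card J \<le> r" "entails \<rho> J C"
    and "\<And>K. K \<subseteq> F \<Longrightarrow> entails \<rho> K C \<Longrightarrow> card J \<le> card K"
proof -
  define P where "P J \<longleftrightarrow> J \<subseteq> F \<and> entails \<rho> J C" for J
  from assms(2) obtain J0 where J0: "P J0" "card J0 \<le> r" by (auto simp: hard_def P_def)
  have "P (arg_min card P)" "\<And>K. P K \<Longrightarrow> card (arg_min card P) \<le> card K"
    using arg_min_natI[of P J0 card] arg_min_nat_le[of P _ card] J0 by auto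
  then show thesis using that[of "arg_min card P"] J0 unfolding P_def by (meson le_trans)
qed

lemma sat_resolvent:
  assumes "is_resolvent A B x R" "sat_clause \<alpha> A" "sat_clause \<alpha> B"
  shows "sat_clause \<alpha> R"
proof (cases "\<alpha> x")
  case True
  have "sat_clause \<alpha> (B - {(x, False)})"
    using assms(3) True unfolding sat_clause_def by blast
  then show ?thesis using assms(1) unfolding is_resolvent_def by (auto intro: sat_clause_mono)
next
  case False
  have "sat_clause \<alpha> (A - {(x, True)})"
    using assms(2) False unfolding sat_clause_def by blast
  then show ?thesis using assms(1) unfolding is_resolvent_def by (auto intro: sat_clause_mono)
qed

text \<open>The least number of axioms entailing a clause is subadditive under resolution, so some
  premise of a hard clause is hard or needs between \<open>r / 2\<close> and \<open>r\<close> axioms; the boundary of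
  these axioms makes it wide.\<close>

lemma hard_resolvent:
  assumes fin: "finite F" and R: "hard F \<rho> r R" "is_resolvent A B x R"
    and finAB: "finite A" "finite B"
    and exp: "\<And>J. J \<subseteq> F \<Longrightarrow> card J \<le> r \<Longrightarrow> r < 2 * card J \<Longrightarrow> w \<le> card (boundary J - fst ` \<rho>)"
  shows "hard F \<rho> r A \<or> hard F \<rho> r B \<or> wide \<rho> w A \<or> wide \<rho> w B"
proof (rule ccontr)
  assume neg: "\<not> ?thesis"
  have small: "\<exists>J\<subseteq>F. 2 * card J \<le> r \<and> entails \<rho> J C"
    if C: "\<not> hard F \<rho> r C" "\<not> wide \<rho> w C" "finite C" for C
  proof -
    obtain J where J: "J \<subseteq> F" "card J \<le> r" "entails \<rho> J C"
      and min: "\<And>K. K \<subseteq> F \<Longrightarrow> entails \<rho> K C \<Longrightarrow> card J \<le> card K"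
      using minimal_entails[OF fin C(1)] by blast
    have "2 * card J \<le> r"
    proof (rule ccontr)
      assume big: "\<not> 2 * card J \<le> r"
      have finJ: "finite J" using J fin finite_subset by blast
      have "boundary J - fst ` \<rho> \<subseteq> fst ` C"
      proof (rule boundary_subset_of_minimal[OF J(3)])
        fix D assume D: "D \<in> J"
        then have "card (J - {D}) < card J" using finJ by (meson card_Diff1_less)
        then show "\<not> entails \<rho> (J - {D}) C" using min[of "J - {D}"] J(1) by fastforce
      qed
      then have "card (boundary J - fst ` \<rho>) \<le> card (fst ` C)"
        using C(3) by (intro card_mono) auto
      moreover have "w \<le> card (boundary J - fst ` \<rho>)" using exp J big by simp
      \<comment> \<open>A literal shared with \<open>\<rho>\<close> would make \<open>C\<close>
        entailed by no clauses at all, against the minimality of the large set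
        \<open>J\<close>.\<close>
      moreover have "C \<inter> \<rho> = {}"
      proof (rule ccontr)
        assume "C \<inter> \<rho> \<noteq> {}"
        then have "entails \<rho> {} C" by (auto simp: entails_def lits_true_def sat_clause_def)
        then have "card J \<le> card ({} :: 'a cnf)" by (intro min) auto
        then show False using big by simp
      qed
      ultimately show False using C(2) by (simp add: wide_def)
    qed
    then show ?thesis using J by blast
  qed
  obtain JA where JA: "JA \<subseteq> F" "2 * card JA \<le> r" "entails \<rho> JA A"
    using small[of A] neg finAB by blast
  obtain JB where JB: "JB \<subseteq> F" "2 * card JB \<le> r" "entails \<rho> JB B"
    using small[of B] neg finAB by blast
  have "card (JA \<union> JB) \<le> r"
    using card_Un_le[of JA JB] JA JB by linarith
  moreover have "entails \<rho> (JA \<union> JB) R"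
    using JA(3) JB(3) sat_resolvent[OF R(2)] by (auto simp: entails_def sat_cnf_def)
  ultimately show False using R(1) JA JB by (auto simp: hard_def)
qed

section \<open>Counting boundary variables\<close>

lemma boundary_subset_vars: "boundary J \<subseteq> cnf_vars J"
  by (auto simp: boundary_def cnf_vars_def)

lemma cnf_vars_eq_UN: "cnf_vars J = (\<Union>D\<in>J. fst ` D)"
  by (auto simp: cnf_vars_def)

text \<open>Double counting of incidences: a variable outside the boundary lies in at least two
  clauses, and a clause has at most \<open>k\<close> variables.\<close>

lemma card_boundary_lower:
  assumes "finite J" "\<And>D. D \<in> J \<Longrightarrow> finite D" "\<And>D. D \<in> J \<Longrightarrow> card (fst ` D) \<le> k"
  shows "2 * card (cnf_vars J) \<le> k * card J + card (boundary J)"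
proof -
  let ?V = "cnf_vars J" and ?B = "boundary J"
  define deg where "deg x = card {D \<in> J. x \<in> fst ` D}" for x
  have finV: "finite ?V" using assms(1,2) by (auto simp: cnf_vars_eq_UN)
  have BV: "?B \<subseteq> ?V" by (rule boundary_subset_vars)
  have "deg x \<ge> 1" if "x \<in> ?V" for x
    using that assms(1) by (auto simp: deg_def cnf_vars_eq_UN Suc_le_eq card_gt_0_iff)
  moreover have "x \<in> ?B" if "deg x = 1" for x
  proof -
    from that obtain D where "{D \<in> J. x \<in> fst ` D} = {D}"
      unfolding deg_def by (auto simp: card_1_singleton_iff)
    then have "D \<in> J \<and> x \<in> fst ` D" "\<And>E. E \<in> J \<and> x \<in> fst ` E \<Longrightarrow> E = D" by blast+
    then show ?thesis unfolding boundary_def by blast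
  qed
  ultimately have "(if x \<in> ?B then 1 else 2) \<le> deg x" if "x \<in> ?V" for x
    using that by (cases "deg x = 1") (fastforce simp: le_eq_less_or_eq)+
  then have "(\<Sum>x\<in>?V. if x \<in> ?B then 1 else 2) \<le> (\<Sum>x\<in>?V. deg x)"
    by (intro sum_mono) auto
  moreover have "(\<Sum>x\<in>?V. if x \<in> ?B then 1 else 2) = card ?B + 2 * card (?V - ?B)"
    using finV BV by (subst sum.If_cases) (auto simp: Int_absorb1 Diff_eq)
  moreover have "card (?V - ?B) = card ?V - card ?B" "card ?B \<le> card ?V"
    using finV BV by (auto simp: card_Diff_subset finite_subset card_mono)
  moreover have "(\<Sum>x\<in>?V. deg x) = (\<Sum>x\<in>?V. \<Sum>D | D \<in> J \<and> x \<in> fst ` D. 1)"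
    by (simp add: deg_def)
  moreover have "\<dots> = (\<Sum>D\<in>J. \<Sum>x | x \<in> ?V \<and> x \<in> fst ` D. 1)"
    using finV assms(1) by (rule sum.swap_restrict)
  moreover have "\<dots> \<le> (\<Sum>D\<in>J. k)"
  proof (rule sum_mono)
    fix D assume D: "D \<in> J"
    then have "{x. x \<in> ?V \<and> x \<in> fst ` D} = fst ` D" by (auto simp: cnf_vars_eq_UN)
    then show "(\<Sum>x | x \<in> ?V \<and> x \<in> fst ` D. 1) \<le> k" using assms(3)[OF D] by simp
  qed
  ultimately show ?thesis by (simp add: mult.commute)
qed

text \<open>The case \<open>D = E\<close> is included, so no clause contains two variables of
  \<open>S\<close>.\<close>

definition separated :: "'v cnf \<Rightarrow> 'v set \<Rightarrow> bool" where
  "separated F S \<longleftrightarrow> (\<forall>x\<in>S. \<forall>y\<in>S. \<forall>D\<in>F. \<forall>E\<in>F. x \<noteq> y \<longrightarrow> x \<in> fst ` D \<longrightarrow> y \<in> fst ` E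
     \<longrightarrow> fst ` D \<inter> fst ` E = {})"

text \<open>If the whole boundary lay in \<open>S\<close>, the clauses owning a boundary variable would form at least
  three quarters of \<open>J\<close>; they are pairwise disjoint, so the others would be too few to cover
  their remaining variables.\<close>

lemma separated_boundary:
  assumes sep: "separated F S" and J: "J \<subseteq> F" "finite J" "J \<noteq> {}" and k: "3 \<le> k"
    and card: "\<And>D. D \<in> J \<Longrightarrow> finite D \<and> card (fst ` D) = k"
    and bd: "3 * card J \<le> 4 * card (boundary J)"
  shows "boundary J - S \<noteq> {}"
proof
  assume "boundary J - S = {}"
  then have BS: "boundary J \<subseteq> S" by blast
  define J1 where "J1 = {D \<in> J. boundary J \<inter> fst ` D \<noteq> {}}"
  define J0 where "J0 = J - J1"
  have J1J: "J1 \<subseteq> J" and fin1: "finite J1" and fin0: "finite J0"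
    using J(2) by (auto simp: J1_def J0_def)
  have same: "x = y" if "x \<in> S" "y \<in> S" "D \<in> J" "x \<in> fst ` D" "y \<in> fst ` D" for x y D
  proof (rule ccontr)
    assume "x \<noteq> y"
    moreover have "D \<in> F" using that(3) J(1) by blast
    ultimately have "fst ` D \<inter> fst ` D = {}" using sep that unfolding separated_def by blast
    then show False using that(4) by blast
  qed
  define own where "own x = (THE D. D \<in> J \<and> x \<in> fst ` D)" for x
  have own: "own x \<in> J \<and> x \<in> fst ` own x" if "x \<in> boundary J" for x
    using that unfolding boundary_def own_def mem_Collect_eq by (rule theI')
  \<comment> \<open>A clause owns at most one boundary variable, since all of these lie in
    \<open>S\<close>.\<close>
  have "card (boundary J) \<le> card J1"
  proof (rule card_inj_on_le[of own])
    show "inj_on own (boundary J)"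
    proof (rule inj_onI)
      fix x y assume xy: "x \<in> boundary J" "y \<in> boundary J" "own x = own y"
      then have "own x \<in> J" "x \<in> fst ` own x" "y \<in> fst ` own x" using own[of x] own[of y] by auto
      moreover have "x \<in> S" "y \<in> S" using xy BS by auto
      ultimately show "x = y" using same by simp
    qed
    show "own ` boundary J \<subseteq> J1" using own by (auto simp: J1_def)
  qed (rule fin1)
  moreover have "card J = card J0 + card J1"
    using J1J J(2) fin1 by (simp add: J0_def card_Diff_subset card_mono)
  ultimately have c1: "3 * card J0 \<le> card J1" using bd by linarith
  have owner: "E = D" if "x \<in> boundary J" "D \<in> J" "E \<in> J" "x \<in> fst ` D" "x \<in> fst ` E" for x D E
    using that unfolding boundary_def by blast
  \<comment> \<open>A variable of \<open>D\<close> outside \<open>S\<close> is not in the boundary,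
    so another clause of \<open>J\<close> contains it. That clause meets \<open>D\<close>, whereas
    owners of different boundary variables are disjoint; hence it lies in \<open>J0\<close>.\<close>
  have cover: "fst ` D - S \<subseteq> cnf_vars J0" and cD: "card (fst ` D - S) = k - 1" if D: "D \<in> J1" for D
  proof -
    obtain x where x: "x \<in> boundary J" "x \<in> fst ` D" "D \<in> J" using D by (auto simp: J1_def)
    have "fst ` D - S = fst ` D - {x}" using same x BS by blast
    then show "card (fst ` D - S) = k - 1" using card x by (simp add: card_Diff_singleton)
    show "fst ` D - S \<subseteq> cnf_vars J0"
    proof
      fix y assume y: "y \<in> fst ` D - S"
      then have "y \<notin> boundary J" using BS by blast
      then obtain E where E: "E \<in> J" "E \<noteq> D" "y \<in> fst ` E"
        using y x(3) unfolding boundary_def by blast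
      have "E \<notin> J1"
      proof
        assume "E \<in> J1"
        then obtain z where z: "z \<in> boundary J" "z \<in> fst ` E" by (auto simp: J1_def)
        then have "x \<noteq> z" using owner x E by metis
        then have "fst ` D \<inter> fst ` E = {}"
          using sep x z E BS J(1) unfolding separated_def by (meson subsetD)
        then show False using y E by blast
      qed
      then show "y \<in> cnf_vars J0" using E by (auto simp: J0_def cnf_vars_eq_UN)
    qed
  qed
  have disj: "(fst ` D - S) \<inter> (fst ` E - S) = {}" if DE: "D \<in> J1" "E \<in> J1" "D \<noteq> E" for D E
  proof -
    obtain x z where x: "x \<in> boundary J" "x \<in> fst ` D" "D \<in> J" and z: "z \<in> boundary J" "z \<in> fst ` E" "E \<in> J"
      using DE by (auto simp: J1_def)
    have "x \<noteq> z" using owner[of x D E] x z DE(3) by auto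
    then have "fst ` D \<inter> fst ` E = {}"
      using sep x z BS J(1) unfolding separated_def by (meson subsetD)
    then show ?thesis by blast
  qed
  have finD: "finite (fst ` D - S)" if "D \<in> J1" for D using card that J1J by auto
  have "card J1 * (k - 1) = (\<Sum>D\<in>J1. card (fst ` D - S))" using cD by simp
  also have "\<dots> = card (\<Union>D\<in>J1. fst ` D - S)"
    using fin1 disj finD by (intro card_UN_disjoint[symmetric]) auto
  also have "\<dots> \<le> card (cnf_vars J0)"
    using cover fin0 card by (intro card_mono) (auto simp: cnf_vars_eq_UN J0_def)
  also have "\<dots> \<le> (\<Sum>D\<in>J0. card (fst ` D))"
    unfolding cnf_vars_eq_UN by (rule card_UN_le[OF fin0])
  also have "\<dots> = card J0 * k" using card by (simp add: J0_def)
  finally have c2: "card J1 * (k - 1) \<le> card J0 * k" .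
  \<comment> \<open>Since 3 (k - 1) > k for k \<ge> 3, this leaves \<open>J0\<close>, and then
    \<open>J1\<close>, empty.\<close>
  have "3 * card J0 * (k - 1) \<le> card J0 * k"
    using c1 c2 mult_le_mono1 le_trans by blast
  moreover obtain l where l: "k = l + 3" using k by (metis add.commute le_Suc_ex)
  ultimately have "card J0 = 0" by (simp add: algebra_simps)
  then have "card J1 = 0" using c2 l by simp
  then show False using \<open>card J0 = 0\<close> \<open>card J = card J0 + card J1\<close> J by simp
qed

section \<open>Random restrictions\<close>

text \<open>A chain rule for events that force the first draw into \<open>G\<close>. It handles
  adaptive draws one at a time, without independence.\<close>

lemma prob_bind_pmf_le:
  assumes "0 \<le> b"
    and "\<And>x. x \<in> set_pmf M \<Longrightarrow> x \<in> G \<Longrightarrow> measure_pmf.prob (f x) E \<le> b"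
    and "\<And>x. x \<in> set_pmf M \<Longrightarrow> x \<notin> G \<Longrightarrow> measure_pmf.prob (f x) E = 0"
  shows "measure_pmf.prob (bind_pmf M f) E \<le> measure_pmf.prob M G * b"
proof -
  have "emeasure (bind_pmf M f) E = (\<integral>\<^sup>+x. emeasure (f x) E \<partial>M)" by simp
  also have "\<dots> \<le> (\<integral>\<^sup>+x. ennreal b * indicator G x \<partial>M)"
  proof (intro nn_integral_mono_AE)
    show "AE x in measure_pmf M. emeasure (f x) E \<le> ennreal b * indicator G x"
      unfolding AE_measure_pmf_iff
      using assms by (auto simp: measure_pmf.emeasure_eq_measure indicator_def ennreal_leI)
  qed
  also have "\<dots> = ennreal b * emeasure M G" by (simp add: nn_integral_cmult_indicator)
  also have "\<dots> = ennreal (measure_pmf.prob M G * b)"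
    using assms(1) by (simp add: measure_pmf.emeasure_eq_measure ennreal_mult mult.commute)
  finally show ?thesis
    using assms(1) by (simp add: measure_pmf.emeasure_eq_measure ennreal_le_iff)
qed

text \<open>The bound varies with the coordinate so that unconstrained coordinates can contribute a
  factor 1.\<close>

lemma prob_replicate_pmf_le:
  assumes "\<And>i. i < m \<Longrightarrow> measure_pmf.prob p (Q i) \<le> b i"
  shows "measure_pmf.prob (replicate_pmf m p) {xs. \<forall>i<m. xs ! i \<in> Q i} \<le> (\<Prod>i<m. b i)"
  using assms
proof (induction m arbitrary: Q b)
  case 0
  then show ?case by simp
next
  case (Suc m)
  have nonneg: "0 \<le> b i" if "i < Suc m" for i
    using Suc.prems[OF that] measure_nonneg order_trans by blast
  have IH: "measure_pmf.prob (replicate_pmf m p) {xs. \<forall>i<m. xs ! i \<in> Q (Suc i)}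
      \<le> (\<Prod>i<m. b (Suc i))"
    by (rule Suc.IH) (use Suc.prems in auto)
  let ?E = "{xs. \<forall>i<Suc m. xs ! i \<in> Q i}"
  have eq: "replicate_pmf (Suc m) p = bind_pmf p (\<lambda>x. map_pmf (Cons x) (replicate_pmf m p))"
    by (simp add: map_pmf_def)
  have vim: "Cons x -` ?E = (if x \<in> Q 0 then {xs. \<forall>i<m. xs ! i \<in> Q (Suc i)} else {})" for x
    by (auto simp: less_Suc_eq_0_disj)
  have pr: "measure_pmf.prob (map_pmf (Cons x) (replicate_pmf m p)) ?E
      = (if x \<in> Q 0 then measure_pmf.prob (replicate_pmf m p) {xs. \<forall>i<m. xs ! i \<in> Q (Suc i)} else 0)" for x
    unfolding measure_map_pmf vim by simp
  have "measure_pmf.prob (replicate_pmf (Suc m) p) ?E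
      \<le> measure_pmf.prob p (Q 0) * (\<Prod>i<m. b (Suc i))"
    unfolding eq
  proof (rule prob_bind_pmf_le)
    show "0 \<le> (\<Prod>i<m. b (Suc i))" by (intro prod_nonneg) (use nonneg in auto)
  qed (use IH in \<open>simp_all only: pr if_True if_False\<close>)
  also have "\<dots> \<le> b 0 * (\<Prod>i<m. b (Suc i))"
    using Suc.prems[of 0] nonneg by (intro mult_right_mono prod_nonneg) auto
  also have "\<dots> = (\<Prod>i<Suc m. b i)" by (simp add: prod.lessThan_Suc_shift del: prod.lessThan_Suc)
  finally show ?case .
qed

lemma prob_replicate_pmf_subset_le:
  assumes "I \<subseteq> {..<m}" "measure_pmf.prob p Q \<le> q"
  shows "measure_pmf.prob (replicate_pmf m p) {xs. \<forall>i\<in>I. xs ! i \<in> Q} \<le> q ^ card I"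
proof -
  have "measure_pmf.prob (replicate_pmf m p) {xs. \<forall>i<m. xs ! i \<in> (if i \<in> I then Q else UNIV)}
      \<le> (\<Prod>i<m. if i \<in> I then q else 1)"
    by (rule prob_replicate_pmf_le) (use assms(2) in auto)
  also have "{xs. \<forall>i<m. xs ! i \<in> (if i \<in> I then Q else UNIV)} = {xs. \<forall>i\<in>I. xs ! i \<in> Q}"
    using assms(1) by auto
  also have "(\<Prod>i<m. if i \<in> I then q else 1) = q ^ card I"
    using assms(1) by (subst prod.If_cases) (auto simp: Int_absorb1)
  finally show ?thesis .
qed

text \<open>Deleting the conflicts of each choice, itself among them in the intended use, makes
  separation certain for every outcome, while each literal remains uniform over the variables still
  available.\<close>

primrec random_lits :: "('v \<Rightarrow> 'v set) \<Rightarrow> nat \<Rightarrow> 'v set \<Rightarrow> 'v clause pmf" where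
  "random_lits conf 0 A = return_pmf {}"
| "random_lits conf (Suc t) A = bind_pmf (pmf_of_set (A \<times> UNIV))
     (\<lambda>l. map_pmf (insert l) (random_lits conf t (A - conf (fst l))))"

text \<open>A step consumes at most \<open>K\<close> variables, so the pool lasts for
  \<open>t\<close> steps. Deletion keeps later variables out of the conflict sets of earlier ones;
  symmetry of \<open>conf\<close> gives the converse.\<close>

lemma set_random_lits:
  assumes "\<rho> \<in> set_pmf (random_lits conf t A)" "finite A" "t * K \<le> card A" "1 \<le> K"
    and "\<And>x. x \<in> A \<Longrightarrow> finite (conf x) \<and> card (conf x) \<le> K \<and> x \<in> conf x"
    and "\<And>x y. y \<in> conf x \<Longrightarrow> x \<in> conf y"
  shows "fst ` \<rho> \<subseteq> A \<and> finite \<rho> \<and> card \<rho> \<le> t \<and> inj_on fst \<rho>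
    \<and> (\<forall>x\<in>fst ` \<rho>. \<forall>y\<in>fst ` \<rho>. x \<noteq> y \<longrightarrow> y \<notin> conf x)"
  using assms(1-3,5)
proof (induction t arbitrary: A \<rho>)
  case 0
  then show ?case by simp
next
  case (Suc t)
  have "card A \<noteq> 0" using Suc.prems(3) assms(4) by auto
  then have ne: "A \<noteq> {}" by auto
  have "\<rho> \<in> (\<Union>l\<in>A \<times> UNIV. insert l ` set_pmf (random_lits conf t (A - conf (fst l))))"
    using Suc.prems(1,2) ne by simp
  then obtain l \<sigma> where "l \<in> A \<times> UNIV"
    and \<sigma>: "\<sigma> \<in> set_pmf (random_lits conf t (A - conf (fst l)))"
    and \<rho>: "\<rho> = insert l \<sigma>"
    by blast
  then have l: "fst l \<in> A" by auto
  have "card A - card (conf (fst l)) \<le> card (A - conf (fst l))"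
    using Suc.prems(4)[OF l] by (intro diff_card_le_card_Diff) auto
  then have c: "t * K \<le> card (A - conf (fst l))"
    using Suc.prems(3) Suc.prems(4)[OF l] by (simp add: algebra_simps) linarith
  have IH: "fst ` \<sigma> \<subseteq> A - conf (fst l) \<and> finite \<sigma> \<and> card \<sigma> \<le> t \<and> inj_on fst \<sigma>
    \<and> (\<forall>x\<in>fst ` \<sigma>. \<forall>y\<in>fst ` \<sigma>. x \<noteq> y \<longrightarrow> y \<notin> conf x)"
    by (rule Suc.IH[OF \<sigma> _ c]) (use Suc.prems in auto)
  have new: "fst l \<notin> fst ` \<sigma>" using IH Suc.prems(4)[OF l] by blast
  have sep: "y \<notin> conf (fst l)" "fst l \<notin> conf y" if "y \<in> fst ` \<sigma>" for y
    using IH that assms(6) by blast+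
  show ?case unfolding \<rho>
    using IH l new sep by (auto simp: card_insert_if inj_on_insert)
qed

text \<open>Every step removes at most \<open>K\<close> variables, so throughout the \<open>t\<close> steps a chosen literal
  lies in \<open>C\<close> with probability at least \<open>q / (2 * n)\<close>.\<close>

lemma prob_random_lits_miss:
  assumes "finite A" "card A \<le> n" "q + t * K \<le> card (A \<inter> fst ` C)" "1 \<le> q"
    and "\<And>x. x \<in> A \<Longrightarrow> finite (conf x) \<and> card (conf x) \<le> K"
  shows "measure_pmf.prob (random_lits conf t A) {\<rho>. C \<inter> \<rho> = {}} \<le> (1 - real q / (2 * real n)) ^ t"
  using assms
proof (induction t arbitrary: A)
  case 0
  then show ?case by simp
next
  case (Suc t)
  have cAC: "card (A \<inter> fst ` C) \<le> card A" using Suc.prems(1) by (intro card_mono) auto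
  then have cA: "0 < card A" "q \<le> card A" "q \<le> n" using Suc.prems(2-4) by auto
  let ?X = "A \<times> (UNIV :: bool set)"
  have X: "finite ?X" "?X \<noteq> {}" using Suc.prems(1) cA by auto
  have b0: "0 \<le> (1 - real q / (2 * real n)) ^ t"
    using cA Suc.prems(4) by (intro zero_le_power) (simp add: field_simps)
  \<comment> \<open>A variable of \<open>C\<close> guarantees only one of its two literals, whence
    the 2 in the denominator.\<close>
  have "card (A \<inter> fst ` C) \<le> card (?X \<inter> C)"
  proof (rule surj_card_le)
    show "A \<inter> fst ` C \<subseteq> fst ` (?X \<inter> C)" by force
  qed (use X in auto)
  then have q: "q \<le> card (?X \<inter> C)" using Suc.prems(3) by linarith
  have "card (?X \<inter> - C) = card ?X - card (?X \<inter> C)"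
    using X(1) by (simp add: Diff_eq[symmetric] card_Diff_subset_Int)
  moreover have "card (?X \<inter> C) \<le> card ?X" using X(1) by (intro card_mono) auto
  ultimately have "real (card (?X \<inter> - C)) \<le> real (card ?X) - real q"
    using q by linarith
  then have "real (card (?X \<inter> - C)) / real (card ?X) \<le> (real (card ?X) - real q) / real (card ?X)"
    by (intro divide_right_mono) auto
  also have "\<dots> = 1 - real q / (2 * real (card A))"
    using cA(1) by (simp add: card_cartesian_product field_simps)
  also have "\<dots> \<le> 1 - real q / (2 * real n)"
    using cA Suc.prems(2,4) by (simp add: frac_le)
  finally have first: "measure_pmf.prob (pmf_of_set ?X) (- C) \<le> 1 - real q / (2 * real n)"
    by (simp add: measure_pmf_of_set[OF X(2,1)])
  have vim: "insert l -` {\<rho>. C \<inter> \<rho> = {}} = (if l \<in> C then {} else {\<rho>. C \<inter> \<rho> = {}})" for l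
    by auto
  have pr: "measure_pmf.prob (map_pmf (insert l) D) {\<rho>. C \<inter> \<rho> = {}}
      = (if l \<in> C then 0 else measure_pmf.prob D {\<rho>. C \<inter> \<rho> = {}})" for l D
    unfolding measure_map_pmf vim by simp
  have IH: "measure_pmf.prob (random_lits conf t (A - conf (fst l))) {\<rho>. C \<inter> \<rho> = {}}
      \<le> (1 - real q / (2 * real n)) ^ t" if "fst l \<in> A" for l :: "'a \<times> bool"
  proof (rule Suc.IH)
    show "card (A - conf (fst l)) \<le> n"
      using Suc.prems(1,2) card_mono[of A "A - conf (fst l)"] by fastforce
    have "(A - conf (fst l)) \<inter> fst ` C = (A \<inter> fst ` C) - conf (fst l)" by blast
    moreover have "card (A \<inter> fst ` C) - card (conf (fst l)) \<le> card ((A \<inter> fst ` C) - conf (fst l))"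
      using Suc.prems(5)[OF that] by (intro diff_card_le_card_Diff) auto
    ultimately show "q + t * K \<le> card ((A - conf (fst l)) \<inter> fst ` C)"
      using Suc.prems(3) Suc.prems(5)[OF that] by (simp add: algebra_simps) linarith
  qed (use Suc.prems in auto)
  have "measure_pmf.prob (random_lits conf (Suc t) A) {\<rho>. C \<inter> \<rho> = {}}
      \<le> measure_pmf.prob (pmf_of_set ?X) (- C) * (1 - real q / (2 * real n)) ^ t"
    unfolding random_lits.simps
    by (rule prob_bind_pmf_le[OF b0]) (use X IH in \<open>auto simp: pr\<close>)
  also have "\<dots> \<le> (1 - real q / (2 * real n)) * (1 - real q / (2 * real n)) ^ t"
    by (rule mult_right_mono[OF first b0])
  finally show ?case by simp
qed

section \<open>Conflicts between variables, and the random refutation of an expanding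
  formula\<close>

definition conflict :: "'v cnf \<Rightarrow> 'v \<Rightarrow> 'v set" where
  "conflict F x = insert x {y. \<exists>D\<in>F. \<exists>E\<in>F. x \<in> fst ` D \<and> y \<in> fst ` E \<and> fst ` D \<inter> fst ` E \<noteq> {}}"

lemma conflict_sym: "y \<in> conflict F x \<Longrightarrow> x \<in> conflict F y"
  unfolding conflict_def by blast

lemma separated_if_no_conflict:
  "(\<forall>x\<in>S. \<forall>y\<in>S. x \<noteq> y \<longrightarrow> y \<notin> conflict F x) \<Longrightarrow> separated F S"
  unfolding separated_def conflict_def by blast

text \<open>For a fixed assignment, \<open>B\<close> can fail only if one of the \<open>L\<close>
  decoded clauses is wide and missed by \<open>\<rho>\<close>. Of the \<open>w\<close> variables of
  such a clause, some lie outside \<open>A\<close> and \<open>t * K\<close> may be deleted during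
  the draws; \<open>q\<close> are still available at every draw.\<close>

lemma random_refutation_of_expansion:
  assumes F: "\<And>D. D \<in> set F \<Longrightarrow> D \<subseteq> {..<n} \<times> UNIV \<and> card (fst ` D) = k" and k: "3 \<le> k"
    and L: "1 \<le> L" "L \<le> 2 ^ n"
    and exp: "\<And>J. J \<subseteq> set F \<Longrightarrow> J \<noteq> {} \<Longrightarrow> card J \<le> r \<Longrightarrow> 3 * card J \<le> 4 * card (boundary J)"
    and A: "A \<subseteq> {..<n}"
    and K: "\<And>x. x \<in> A \<Longrightarrow> finite (conflict (set F) x) \<and> card (conflict (set F) x) \<le> K" "1 \<le> K"
    and r: "1 \<le> r" "8 * w + 8 * t \<le> 3 * r"
    and q: "1 \<le> q" "q + t * K + card ({..<n} - A) \<le> w" "w \<le> n"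
  shows "\<exists>D. random_refutation D (sLB F n L) (real L * (1 - real q / (2 * real n)) ^ t)
    (real (9 * n + 1))"
proof -
  define M where "M = random_lits (conflict (set F)) t A"
  define B where "B \<rho> = wide_axioms n L (wide \<rho> w)" for \<rho> :: "nat clause"
  have finA: "finite A" using A finite_subset by blast
  have cA: "card ({..<n} - A) = n - card A" "card A \<le> n"
    using A finA card_mono[of "{..<n}" A] by (auto simp: card_Diff_subset)
  have tK: "t * K \<le> card A" using q cA by linarith
  have finF: "finite D" if "D \<in> set F" for D
    using F[OF that] finite_subset[of D "{..<n} \<times> UNIV"] by auto
  have ref: "\<exists>P. is_refutation (sLB F n L \<union> B \<rho>) P \<and> ref_width P \<le> 9 * n + 1"
    if \<rho>: "\<rho> \<in> set_pmf M" for \<rho>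
  proof (rule derivable_empty_imp_refutation)
    have supp: "finite \<rho>" "card \<rho> \<le> t" "inj_on fst \<rho>"
      "\<forall>x\<in>fst ` \<rho>. \<forall>y\<in>fst ` \<rho>. x \<noteq> y \<longrightarrow> y \<notin> conflict (set F) x"
    proof -
      have K': "finite (conflict (set F) x) \<and> card (conflict (set F) x) \<le> K \<and> x \<in> conflict (set F) x"
        if "x \<in> A" for x
        using K(1)[OF that] by (simp add: conflict_def)
      show "finite \<rho>" "card \<rho> \<le> t" "inj_on fst \<rho>"
        "\<forall>x\<in>fst ` \<rho>. \<forall>y\<in>fst ` \<rho>. x \<noteq> y \<longrightarrow> y \<notin> conflict (set F) x"
        using set_random_lits[OF \<rho>[unfolded M_def] finA tK K(2) K' conflict_sym] by simp_all
    qed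
    have sep: "separated (set F) (fst ` \<rho>)"
      by (rule separated_if_no_conflict[OF supp(4)])
    have bd: "boundary J - fst ` \<rho> \<noteq> {}" if "J \<subseteq> set F" "J \<noteq> {}" "card J \<le> r" for J
    proof (rule separated_boundary[OF sep that(1) _ that(2) k])
      show "finite J" using that(1) by (rule finite_subset) simp
      show "finite D \<and> card (fst ` D) = k" if "D \<in> J" for D
        using F[of D] finF[of D] that \<open>J \<subseteq> set F\<close> by blast
      show "3 * card J \<le> 4 * card (boundary J)" by (rule exp[OF that])
    qed
    \<comment> \<open>More than \<open>r / 2\<close> clauses have a boundary above
      \<open>3 * r / 8\<close>, of which \<open>\<rho>\<close> takes at most \<open>t\<close>; this
      is the condition on \<open>w\<close> and \<open>t\<close>.\<close>
    have med: "w \<le> card (boundary J - fst ` \<rho>)"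
      if J: "J \<subseteq> set F" "card J \<le> r" "r < 2 * card J" for J
    proof -
      have "3 * card J \<le> 4 * card (boundary J)" using J by (intro exp) auto
      moreover have "card (boundary J) - card (fst ` \<rho>) \<le> card (boundary J - fst ` \<rho>)"
        using supp by (intro diff_card_le_card_Diff) auto
      moreover have "card (fst ` \<rho>) \<le> t"
        using card_image_le[OF supp(1), of fst] supp(2) by linarith
      ultimately show ?thesis using J(3) r(2) by linarith
    qed
    show "derivable (sLB F n L \<union> B \<rho>) (9 * n + 1) {}"
      unfolding B_def
    proof (rule sLB_derivable_empty[OF L order_refl, where Hd = "hard (set F) \<rho> r"])
      show "hard (set F) \<rho> r {}"
        by (rule hard_empty) (use supp(3) bd in auto)
      show "\<not> D \<subseteq> C" if "hard (set F) \<rho> r C" "D \<in> set F" for C D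
        using hard_no_axiom[OF that r(1)] .
      show "hard (set F) \<rho> r C'" if "hard (set F) \<rho> r C" "C' \<subseteq> C" for C C'
        using hard_mono[OF that] .
      fix A B x R
      assume "hard (set F) \<rho> r R" "is_resolvent A B x R"
        and sub: "A \<subseteq> {..<n} \<times> UNIV" "B \<subseteq> {..<n} \<times> UNIV"
      moreover have "finite A" "finite B"
        using sub finite_subset[of _ "{..<n} \<times> (UNIV :: bool set)"] by auto
      ultimately show "hard (set F) \<rho> r A \<or> hard (set F) \<rho> r B \<or> wide \<rho> w A \<or> wide \<rho> w B"
        using med by (intro hard_resolvent) auto
    qed
  qed
  obtain P where P: "\<And>\<rho>. \<rho> \<in> set_pmf M \<Longrightarrow>
      is_refutation (sLB F n L \<union> B \<rho>) (P \<rho>) \<and> ref_width (P \<rho>) \<le> 9 * n + 1"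
    using ref by metis
  have "random_refutation (map_pmf (\<lambda>\<rho>. (P \<rho>, B \<rho>)) M) (sLB F n L)
      (real L * (1 - real q / (2 * real n)) ^ t) (real (9 * n + 1))"
    unfolding random_refutation_def
  proof (intro conjI allI)
    show "\<forall>(P, B)\<in>set_pmf (map_pmf (\<lambda>\<rho>. (P \<rho>, B \<rho>)) M). (\<forall>C\<in>B. fst ` C \<subseteq> cnf_vars (sLB F n L)) \<and>
        is_refutation (sLB F n L \<union> B) P \<and> real (ref_width P) \<le> real (9 * n + 1)"
    proof
      fix PB assume "PB \<in> set_pmf (map_pmf (\<lambda>\<rho>. (P \<rho>, B \<rho>)) M)"
      then obtain \<rho> where \<rho>: "\<rho> \<in> set_pmf M" and PB: "PB = (P \<rho>, B \<rho>)" by auto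
      have "fst ` C \<subseteq> cnf_vars (sLB F n L)" if "C \<in> B \<rho>" for C
        using that wide_axioms_vars unfolding B_def by blast
      then show "case PB of (P, B) \<Rightarrow> (\<forall>C\<in>B. fst ` C \<subseteq> cnf_vars (sLB F n L)) \<and>
          is_refutation (sLB F n L \<union> B) P \<and> real (ref_width P) \<le> real (9 * n + 1)"
        using P[OF \<rho>] unfolding PB prod.case of_nat_le_iff by blast
    qed
    fix \<alpha> :: "evar \<Rightarrow> bool"
    let ?p = "(1 - real q / (2 * real n)) ^ t"
    have nonneg: "0 \<le> ?p"
    proof (rule zero_le_power)
      have "real q \<le> 2 * real n" using q by linarith
      then show "0 \<le> 1 - real q / (2 * real n)" using divide_le_eq_1[of "real q"] by auto
    qed
    let ?W = "\<lambda>j. {\<rho>. wide \<rho> w (enc_clause n \<alpha> j)}"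
    have one: "measure_pmf.prob M (?W j) \<le> ?p" for j
    proof (cases "w \<le> card (fst ` enc_clause n \<alpha> j)")
      case True
      let ?C = "enc_clause n \<alpha> j"
      have V: "fst ` ?C \<subseteq> {..<n}" by (auto simp: enc_clause_def)
      then have finV: "finite (fst ` ?C)" using finite_subset by blast
      have "card (fst ` ?C) \<le> card ((A \<inter> fst ` ?C) \<union> ({..<n} - A))"
        using V finA by (intro card_mono) auto
      also have "\<dots> \<le> card (A \<inter> fst ` ?C) + card ({..<n} - A)" by (rule card_Un_le)
      finally have "q + t * K \<le> card (A \<inter> fst ` ?C)" using q True by linarith
      then have "measure_pmf.prob M {\<rho>. ?C \<inter> \<rho> = {}} \<le> ?p"
        unfolding M_def using finA cA q K by (intro prob_random_lits_miss) auto
      moreover have "?W j = {\<rho>. ?C \<inter> \<rho> = {}}" using True by (auto simp: wide_def)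
      ultimately show ?thesis by simp
    next
      case False
      then have "?W j = {}" by (auto simp: wide_def)
      then show ?thesis using nonneg by simp
    qed
    have "measure_pmf.prob M (\<Union>j<L. ?W j) \<le> (\<Sum>j<L. measure_pmf.prob M (?W j))"
      by (rule measure_pmf.finite_measure_subadditive_finite) auto
    also have "\<dots> \<le> real L * ?p"
      using sum_bounded_above[of "{..<L}" "\<lambda>j. measure_pmf.prob M (?W j)" ?p] one by simp
    finally have bad: "measure_pmf.prob M (\<Union>j<L. ?W j) \<le> real L * ?p" .
    have "1 - real L * ?p \<le> measure_pmf.prob M (- (\<Union>j<L. ?W j))"
      using bad by (subst measure_pmf.prob_compl[of "\<Union>j<L. ?W j" M, simplified, folded Compl_eq_Diff_UNIV]) simp
    also have "\<dots> \<le> measure_pmf.prob M {\<rho>. sat_cnf \<alpha> (B \<rho>)}"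
      unfolding B_def by (intro measure_pmf.finite_measure_mono) (auto intro: sat_wide_axioms)
    also have "\<dots> = measure_pmf.prob (map_pmf (\<lambda>\<rho>. (P \<rho>, B \<rho>)) M) {(P, B). sat_cnf \<alpha> B}"
      by (simp add: vimage_def)
    finally show "1 - real L * ?p
        \<le> measure_pmf.prob (map_pmf (\<lambda>\<rho>. (P \<rho>, B \<rho>)) M) {(P, B). sat_cnf \<alpha> B}" .
  qed
  then show ?thesis by blast
qed

lemma card_UN_le_mult:
  assumes "finite I" "card I \<le> a" "\<And>i. i \<in> I \<Longrightarrow> card (S i) \<le> b"
  shows "card (\<Union>i\<in>I. S i) \<le> a * b"
proof -
  have "card (\<Union>i\<in>I. S i) \<le> (\<Sum>i\<in>I. card (S i))" by (rule card_UN_le[OF assms(1)])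
  also have "\<dots> \<le> card I * b" using sum_bounded_above[of I "\<lambda>i. card (S i)" b] assms(3) by simp
  also have "\<dots> \<le> a * b" using assms(2) by simp
  finally show ?thesis .
qed

text \<open>The discarded variables are those sharing a clause with a variable of degree above \<open>\<Delta>\<close>.\<close>

lemma few_conflicts:
  fixes F :: "nat cnf"
  assumes F: "finite F" "card F \<le> m"
    and D: "\<And>D. D \<in> F \<Longrightarrow> finite D \<and> fst ` D \<subseteq> {..<n} \<and> card (fst ` D) \<le> k"
    and touch: "\<And>U. U \<subseteq> {..<n} \<Longrightarrow> card U \<le> u \<Longrightarrow> card {D \<in> F. fst ` D \<inter> U \<noteq> {}} \<le> h"
    and u: "k * m \<le> u * \<Delta>"
  shows "\<exists>A\<subseteq>{..<n}. card ({..<n} - A) \<le> h * k \<and>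
    (\<forall>x\<in>A. finite (conflict F x) \<and> card (conflict F x) \<le> 1 + \<Delta> * (k * (\<Delta> * k)))"
proof -
  define deg where "deg x = card {D \<in> F. x \<in> fst ` D}" for x
  define U where "U = {x \<in> {..<n}. \<Delta> < deg x}"
  have U: "U \<subseteq> {..<n}" by (auto simp: U_def)
  then have finU: "finite U" by (rule finite_subset) simp
  \<comment> \<open>Markov's inequality for degrees, whose total is at most
    \<open>k * m\<close>.\<close>
  have "card U * Suc \<Delta> \<le> (\<Sum>x\<in>U. deg x)"
    using sum_bounded_below[of U "Suc \<Delta>" deg] by (auto simp: U_def)
  also have "\<dots> = (\<Sum>x\<in>U. \<Sum>D | D \<in> F \<and> x \<in> fst ` D. 1)" by (simp add: deg_def)
  also have "\<dots> = (\<Sum>D\<in>F. \<Sum>x | x \<in> U \<and> x \<in> fst ` D. 1)"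
    using finU F(1) by (rule sum.swap_restrict)
  also have "\<dots> \<le> (\<Sum>D\<in>F. k)"
  proof (rule sum_mono)
    fix E assume E: "E \<in> F"
    have "card {x. x \<in> U \<and> x \<in> fst ` E} \<le> card (fst ` E)"
      using D[OF E] by (intro card_mono) auto
    then show "(\<Sum>x | x \<in> U \<and> x \<in> fst ` E. 1) \<le> k" using D[OF E] by simp
  qed
  also have "\<dots> \<le> k * m" using F(2) by (simp add: mult.commute)
  finally have "card U * Suc \<Delta> \<le> u * Suc \<Delta>" using u by (simp add: le_trans[OF _ add_increasing])
  then have cU: "card U \<le> u" by (simp del: mult_Suc_right)
  define T where "T = {D \<in> F. fst ` D \<inter> U \<noteq> {}}"
  define A where "A = {..<n} - (\<Union>D\<in>T. fst ` D)"
  have T: "finite T" "card T \<le> h" using F touch[OF U cU] by (auto simp: T_def)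
  have "{..<n} - A \<subseteq> (\<Union>D\<in>T. fst ` D)" by (auto simp: A_def)
  then have "card ({..<n} - A) \<le> card (\<Union>D\<in>T. fst ` D)"
    using T D by (intro card_mono) (auto simp: T_def)
  also have "\<dots> \<le> h * k" using T D by (intro card_UN_le_mult) (auto simp: T_def)
  finally have 1: "card ({..<n} - A) \<le> h * k" .
  \<comment> \<open>A clause through a high-degree variable has all its variables discarded. So
    every variable sharing a clause with a surviving \<open>x\<close>, and not only
    \<open>x\<close>, has small degree.\<close>
  have low: "deg z \<le> \<Delta>" if "E \<in> F" "x \<in> A" "x \<in> fst ` E" "z \<in> fst ` E" for x z E
  proof (rule ccontr)
    assume "\<not> deg z \<le> \<Delta>"
    then have "z \<in> U" using D[OF that(1)] that(4) by (auto simp: U_def)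
    then have "E \<in> T" using that by (auto simp: T_def)
    then show False using that(2,3) by (auto simp: A_def)
  qed
  have 2: "finite (conflict F x) \<and> card (conflict F x) \<le> 1 + \<Delta> * (k * (\<Delta> * k))" if x: "x \<in> A" for x
  proof -
    define N where "N z = {E \<in> F. z \<in> fst ` E}" for z
    \<comment> \<open>A conflict is reached from \<open>x\<close> by passing through two clauses;
      the four unions branch at most \<open>\<Delta>\<close>, \<open>k\<close>,
      \<open>\<Delta>\<close> and \<open>k\<close> ways.\<close>
    let ?R = "\<Union>E\<in>N x. \<Union>z\<in>fst ` E. \<Union>G\<in>N z. fst ` G"
    have finN: "finite (N z)" for z using F by (simp add: N_def)
    have degN: "deg z = card (N z)" for z by (simp add: deg_def N_def)
    have fin: "finite ?R" using finN D by (auto simp: N_def)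
    have "card (N x) \<le> \<Delta>"
    \<comment> \<open>\<open>low\<close> speaks only of variables that occur in some clause, so
      degree 0 is treated apart.\<close>
    proof (cases "N x = {}")
      case False
      then show ?thesis using low[OF _ x] by (auto simp: degN[symmetric]) (auto simp: N_def)
    qed simp
    then have "card ?R \<le> \<Delta> * (k * (\<Delta> * k))"
    proof (rule card_UN_le_mult[OF finN])
      fix E assume "E \<in> N x"
      then have E: "E \<in> F" "x \<in> fst ` E" by (auto simp: N_def)
      show "card (\<Union>z\<in>fst ` E. \<Union>G\<in>N z. fst ` G) \<le> k * (\<Delta> * k)"
      proof (rule card_UN_le_mult)
        show "finite (fst ` E)" "card (fst ` E) \<le> k" using D[OF E(1)] by auto
        show "card (\<Union>G\<in>N z. fst ` G) \<le> \<Delta> * k" if "z \<in> fst ` E" for z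
          by (rule card_UN_le_mult[OF finN])
             (use low[OF E(1) x E(2) that] degN D in \<open>auto simp: N_def\<close>)
      qed
    qed
    moreover have sub: "conflict F x \<subseteq> insert x ?R"
      unfolding conflict_def N_def by blast
    moreover have "card (insert x ?R) \<le> 1 + card ?R"
      using fin by (simp add: card_insert_if)
    moreover have "card (conflict F x) \<le> card (insert x ?R)"
      using fin sub by (intro card_mono) auto
    ultimately show ?thesis
      using fin finite_subset[OF sub] by simp
  qed
  show ?thesis using 1 2 by (intro exI[of _ A]) (auto simp: A_def)
qed

section \<open>Random formulas\<close>

definition ordinary_on :: "nat \<Rightarrow> nat set \<Rightarrow> nat cnf" where
  "ordinary_on k W = {C. C \<subseteq> W \<times> UNIV \<and> card C = k \<and> card (fst ` C) = k}"

lemma ordinary_clauses_eq: "ordinary_clauses k n = ordinary_on k {..<n}"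
  by (simp add: ordinary_clauses_def ordinary_on_def)

lemma finite_ordinary_on: "finite W \<Longrightarrow> finite (ordinary_on k W)"
  by (rule finite_subset[of _ "Pow (W \<times> UNIV)"]) (auto simp: ordinary_on_def)

text \<open>A clause is a set \<open>V\<close> of \<open>k\<close> variables together with the
  subset \<open>P\<close> of those that occur positively.\<close>

lemma card_ordinary_on:
  assumes "finite W"
  shows "card (ordinary_on k W) = (card W choose k) * 2 ^ k"
proof -
  define G where "G = (\<lambda>(V, P). (\<lambda>x :: nat. (x, x \<in> P)) ` V)"
  let ?S = "SIGMA V:{V. V \<subseteq> W \<and> card V = k}. Pow V"
  have fstG: "fst ` G (V, P) = V" for V P by (force simp: G_def)
  have "bij_betw G ?S (ordinary_on k W)"
    unfolding bij_betw_def
  proof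
    show "inj_on G ?S"
    proof (rule inj_onI, clarify)
      fix V P V' P' assume P: "P \<subseteq> V" "P' \<subseteq> V'" and eq: "G (V, P) = G (V', P')"
      have V: "V = V'" using fstG eq by metis
      have "x \<in> P \<longleftrightarrow> x \<in> P'" if "x \<in> V" for x
      proof -
        have "(x, x \<in> P) \<in> G (V, P)" using that by (auto simp: G_def)
        then have "(x, x \<in> P) \<in> G (V', P')" using eq by simp
        then show ?thesis by (auto simp: G_def)
      qed
      then show "V = V' \<and> P = P'" using V P by blast
    qed
    show "G ` ?S = ordinary_on k W"
    proof
      show "G ` ?S \<subseteq> ordinary_on k W"
      proof clarify
        fix V P assume V: "V \<subseteq> W" "k = card V"
        have "inj_on (\<lambda>x. (x, x \<in> P)) V" by (rule inj_onI) simp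
        then have "card (G (V, P)) = card V" by (simp add: G_def card_image)
        then show "G (V, P) \<in> ordinary_on (card V) W"
          using V fstG by (auto simp: ordinary_on_def G_def)
      qed
      show "ordinary_on k W \<subseteq> G ` ?S"
      proof
        fix C assume C: "C \<in> ordinary_on k W"
        then have CW: "C \<subseteq> W \<times> UNIV" "card C = k" "card (fst ` C) = k" by (auto simp: ordinary_on_def)
        have "finite C" using CW(1) assms finite_subset by fastforce
        then have inj: "inj_on fst C" using CW by (intro eq_card_imp_inj_on) auto
        define P where "P = {x. (x, True) \<in> C}"
        have sign: "b \<longleftrightarrow> x \<in> P" if "(x, b) \<in> C" for x b
          using inj_onD[OF inj, of "(x, b)" "(x, True)"] that by (auto simp: P_def)
        have "C = G (fst ` C, P)"
        proof
          show "C \<subseteq> G (fst ` C, P)" using sign by (force simp: G_def)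
          show "G (fst ` C, P) \<subseteq> C" using sign by (force simp: G_def)
        qed
        moreover have "(fst ` C, P) \<in> ?S" using CW by (force simp: P_def)
        ultimately show "C \<in> G ` ?S" by blast
      qed
    qed
  qed
  then have "card (ordinary_on k W) = card ?S" by (simp add: bij_betw_same_card)
  also have "\<dots> = (\<Sum>V | V \<subseteq> W \<and> card V = k. card (Pow V))"
    using assms by (subst card_SigmaI) (auto intro: finite_subset)
  also have "\<dots> = (\<Sum>V | V \<subseteq> W \<and> card V = k. 2 ^ k)"
    using assms by (intro sum.cong) (auto simp: card_Pow finite_subset)
  also have "\<dots> = (card W choose k) * 2 ^ k" using assms by (simp add: n_subsets)
  finally show ?thesis .
qed

lemma prob_ordinary:
  assumes "k \<le> n" "W \<subseteq> {..<n}"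
  shows "measure_pmf.prob (pmf_of_set (ordinary_clauses k n)) {C. fst ` C \<subseteq> W}
    = real (card W choose k) / real (n choose k)"
proof -
  have fin: "finite (ordinary_clauses k n)" by (simp add: ordinary_clauses_eq finite_ordinary_on)
  have card: "card (ordinary_clauses k n) = (n choose k) * 2 ^ k"
    by (simp add: ordinary_clauses_eq card_ordinary_on)
  then have ne: "ordinary_clauses k n \<noteq> {}" using assms(1) by (auto simp: binomial_eq_0_iff)
  have "ordinary_clauses k n \<inter> {C. fst ` C \<subseteq> W} = ordinary_on k W"
    using assms(2) by (force simp: ordinary_clauses_def ordinary_on_def)
  moreover have "card (ordinary_on k W) = (card W choose k) * 2 ^ k"
    using assms(2) finite_subset by (intro card_ordinary_on) auto
  ultimately show ?thesis by (simp add: measure_pmf_of_set[OF ne fin] card)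
qed

lemma set_pmf_ordinary:
  assumes "k \<le> n"
  shows "set_pmf (pmf_of_set (ordinary_clauses k n)) = ordinary_clauses k n"
proof -
  have "card (ordinary_clauses k n) \<noteq> 0"
    using assms by (simp add: ordinary_clauses_eq card_ordinary_on binomial_eq_0_iff)
  then show ?thesis by (intro set_pmf_of_set) (auto simp: card_eq_0_iff)
qed

text \<open>Factor by factor: (h - i) / (n - i) \<le> h / n, because h \<le> n.\<close>

lemma binomial_ratio_le:
  assumes "h \<le> n" "k \<le> n"
  shows "real (h choose k) / real (n choose k) \<le> (real h / real n) ^ k"
proof (cases "k \<le> h")
  case False
  then show ?thesis by (simp add: binomial_eq_0)
next
  case True
  have "real (h choose k) / real (n choose k)
      = (\<Prod>i = 0..<k. real (h - i) / real (k - i)) / (\<Prod>i = 0..<k. real (n - i) / real (k - i))"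
    using binomial_altdef_of_nat[of k h, where 'a = real] binomial_altdef_of_nat[of k n, where 'a = real]
      True assms by simp
  also have "\<dots> = (\<Prod>i = 0..<k. (real (h - i) / real (k - i)) / (real (n - i) / real (k - i)))"
    by (rule prod_dividef[symmetric])
  also have "\<dots> \<le> (\<Prod>i = 0..<k. real h / real n)"
  proof (intro prod_mono conjI)
    fix i assume i: "i \<in> {0..<k}"
    then have "(real (h - i) / real (k - i)) / (real (n - i) / real (k - i)) = real (h - i) / real (n - i)"
      by simp
    also have "\<dots> \<le> real h / real n"
    proof -
      have "real i * real h \<le> real i * real n" using assms by (intro mult_left_mono) auto
      then have "real (h - i) * real n \<le> real h * real (n - i)"
        using i True assms by (simp add: of_nat_diff algebra_simps)
      then show ?thesis using i True assms by (simp add: divide_simps)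
    qed
    finally show "(real (h - i) / real (k - i)) / (real (n - i) / real (k - i)) \<le> real h / real n" .
  qed auto
  finally show ?thesis by simp
qed

lemma prob_ordinary_subset_le:
  assumes "k \<le> n" "W \<subseteq> {..<n}"
  shows "measure_pmf.prob (pmf_of_set (ordinary_clauses k n)) {C. fst ` C \<subseteq> W}
    \<le> (real (card W) / real n) ^ k"
  using binomial_ratio_le[of "card W" n k] card_mono[OF _ assms(2)] assms
  by (simp add: prob_ordinary)

lemma prob_ordinary_touch_le:
  assumes "k \<le> n" "1 \<le> n" "U \<subseteq> {..<n}"
  shows "measure_pmf.prob (pmf_of_set (ordinary_clauses k n)) {C. fst ` C \<inter> U \<noteq> {}}
    \<le> real k * real (card U) / real n"
proof -
  let ?p = "pmf_of_set (ordinary_clauses k n)"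
  have one: "measure_pmf.prob ?p {C. x \<in> fst ` C} \<le> real k / real n" if x: "x < n" for x
  proof -
    let ?N = "{C. fst ` C \<subseteq> {..<n} - {x}}"
    have "real (n - k) * real (n choose k) = real n * real ((n - 1) choose k)"
      using binomial_absorb_comp[of n k] by (metis of_nat_mult)
    moreover have "real (n choose k) > 0" using assms(1) by simp
    ultimately have "real ((n - 1) choose k) / real (n choose k) = real (n - k) / real n"
      using assms(2) by (simp add: frac_eq_eq mult.commute)
    then have "measure_pmf.prob ?p ?N = real (n - k) / real n"
      using prob_ordinary[OF assms(1), of "{..<n} - {x}"] x by (simp add: card_Diff_singleton)
    also have "\<dots> = 1 - real k / real n" using assms by (simp add: of_nat_diff field_simps)
    finally have N: "measure_pmf.prob ?p ?N = 1 - real k / real n" .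
    have "measure_pmf.prob ?p {C. x \<in> fst ` C} \<le> measure_pmf.prob ?p (- ?N)"
      by (intro measure_pmf.finite_measure_mono) auto
    also have "\<dots> = 1 - measure_pmf.prob ?p ?N"
      using measure_pmf.prob_compl[of ?N ?p] by (simp add: Compl_eq_Diff_UNIV)
    finally show ?thesis using N by simp
  qed
  have "{C. fst ` C \<inter> U \<noteq> {}} = (\<Union>x\<in>U. {C :: nat clause. x \<in> fst ` C})" by blast
  moreover have "measure_pmf.prob ?p (\<Union>x\<in>U. {C. x \<in> fst ` C}) \<le> (\<Sum>x\<in>U. measure_pmf.prob ?p {C. x \<in> fst ` C})"
    using finite_subset[OF assms(3)] by (intro measure_pmf.finite_measure_subadditive_finite) auto
  ultimately have "measure_pmf.prob ?p {C. fst ` C \<inter> U \<noteq> {}} \<le> (\<Sum>x\<in>U. measure_pmf.prob ?p {C. x \<in> fst ` C})"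
    by simp
  also have "\<dots> \<le> (\<Sum>x\<in>U. real k / real n)" using one assms(3) by (intro sum_mono) auto
  finally show ?thesis by (simp add: mult.commute)
qed

section \<open>Union bounds over subformulas\<close>

lemma prob_replicate_union_bound:
  assumes "finite X" "finite Y" "\<And>I. I \<in> X \<Longrightarrow> I \<subseteq> {..<m} \<and> card I = s"
    and "\<And>W. W \<in> Y \<Longrightarrow> measure_pmf.prob p (Q W) \<le> q"
  shows "measure_pmf.prob (replicate_pmf m p) {xs. \<exists>I\<in>X. \<exists>W\<in>Y. \<forall>i\<in>I. xs ! i \<in> Q W}
    \<le> real (card X) * real (card Y) * q ^ s"
proof -
  have "{xs. \<exists>I\<in>X. \<exists>W\<in>Y. \<forall>i\<in>I. xs ! i \<in> Q W} = (\<Union>z\<in>X \<times> Y. {xs. \<forall>i\<in>fst z. xs ! i \<in> Q (snd z)})"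
    by force
  then have "measure_pmf.prob (replicate_pmf m p) {xs. \<exists>I\<in>X. \<exists>W\<in>Y. \<forall>i\<in>I. xs ! i \<in> Q W}
      \<le> (\<Sum>z\<in>X \<times> Y. measure_pmf.prob (replicate_pmf m p) {xs. \<forall>i\<in>fst z. xs ! i \<in> Q (snd z)})"
    using assms(1,2)
    by (simp only:) (rule measure_pmf.finite_measure_subadditive_finite, auto)
  also have "\<dots> \<le> (\<Sum>z\<in>X \<times> Y. q ^ s)"
  proof (rule sum_mono)
    fix z assume "z \<in> X \<times> Y"
    then have "fst z \<subseteq> {..<m}" "card (fst z) = s" "measure_pmf.prob p (Q (snd z)) \<le> q"
      using assms(3)[of "fst z"] assms(4)[of "snd z"] by (simp_all add: mem_Times_iff)
    then show "measure_pmf.prob (replicate_pmf m p) {xs. \<forall>i\<in>fst z. xs ! i \<in> Q (snd z)} \<le> q ^ s"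
      using prob_replicate_pmf_subset_le[of "fst z" m p "Q (snd z)" q] by simp
  qed
  finally show ?thesis by (simp add: card_cartesian_product)
qed

text \<open>\<open>F\<close> may repeat clauses, while independence concerns positions; one position
  is selected for each clause.\<close>

lemma set_subset_index_image:
  assumes "J \<subseteq> set F"
  obtains I where "I \<subseteq> {..<length F}" "card I = card J" "(!) F ` I = J"
proof -
  have "J \<subseteq> (!) F ` {..<length F}" using assms by (fastforce simp: in_set_conv_nth)
  then obtain I where "I \<subseteq> {..<length F}" "inj_on ((!) F) I" "J = (!) F ` I"
    by (auto simp: subset_image_inj)
  then show thesis using that by (metis card_image)
qed

lemma set_random_kcnf:
  assumes "k \<le> n" "F \<in> set_pmf (random_kcnf k n m)"
  shows "length F = m" "set F \<subseteq> ordinary_clauses k n"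
  using assms by (auto simp: random_kcnf_def set_replicate_pmf set_pmf_ordinary lists_eq_set)

text \<open>For k = 3 the ratio must exceed 3/5 for the counting in
  \<open>separated_boundary\<close> and stay below 1 for the union bound over random formulas; 3/4
  lies between, and larger \<open>k\<close> only widens the range.\<close>

definition expanding :: "nat \<Rightarrow> nat clause list \<Rightarrow> bool" where
  "expanding r F \<longleftrightarrow> (\<forall>J\<subseteq>set F. J \<noteq> {} \<longrightarrow> card J \<le> r \<longrightarrow> 3 * card J \<le> 4 * card (boundary J))"

text \<open>By \<open>card_boundary_lower\<close>, \<open>s\<close> clauses that violate expansion
  have at most (4k + 3) s / 8 variables; the union is over their positions and a set containing
  these variables.\<close>

lemma prob_not_expanding_le:
  assumes "k \<le> n" "k * r \<le> n" "3 \<le> k"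
  shows "measure_pmf.prob (random_kcnf k n m) {F. \<not> expanding r F}
    \<le> (\<Sum>s=1..r. real (m choose s) * real (n choose ((4 * k + 3) * s div 8))
         * (real ((4 * k + 3) * s div 8) / real n) ^ (k * s))"
proof -
  define h where "h s = (4 * k + 3) * s div 8" for s
  define p where "p = pmf_of_set (ordinary_clauses k n)"
  define X where "X s = {I. I \<subseteq> {..<m} \<and> card I = s}" for s
  define Y where "Y s = {W. W \<subseteq> {..<n} \<and> card W = h s}" for s
  define E where "E s = {F :: nat clause list. \<exists>I\<in>X s. \<exists>W\<in>Y s. \<forall>i\<in>I. F ! i \<in> {C. fst ` C \<subseteq> W}}" for s
  have fin: "finite (X s)" "finite (Y s)" for s by (auto simp: X_def Y_def)
  have card: "card (X s) = m choose s" "card (Y s) = n choose h s" for s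
    by (auto simp: X_def Y_def n_subsets)
  have hle: "h s \<le> k * s" for s
  proof -
    have "(4 * k + 3) * s \<le> (k * s) * 8" using assms(3) by (simp add: algebra_simps)
    then show ?thesis unfolding h_def by linarith
  qed
  have "measure_pmf.prob (random_kcnf k n m) {F. \<not> expanding r F}
      \<le> measure_pmf.prob (random_kcnf k n m) (\<Union>s\<in>{1..r}. E s)"
  proof (rule measure_pmf.finite_measure_mono_AE)
    have "F \<in> (\<Union>s\<in>{1..r}. E s)" if F: "F \<in> set_pmf (random_kcnf k n m)" "\<not> expanding r F" for F
    proof -
      obtain J where J: "J \<subseteq> set F" "J \<noteq> {}" "card J \<le> r" "4 * card (boundary J) < 3 * card J"
        using F(2) by (auto simp: expanding_def not_le)
      have ord: "length F = m" "set F \<subseteq> ordinary_clauses k n" using set_random_kcnf[OF assms(1) F(1)] .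
      have finJ: "finite J" using J(1) finite_subset by blast
      have DJ: "finite D" "card (fst ` D) = k" "fst ` D \<subseteq> {..<n}" if "D \<in> J" for D
      proof -
        have D: "D \<subseteq> {..<n} \<times> UNIV" "card (fst ` D) = k"
          using that J(1) ord(2) by (auto simp: ordinary_clauses_def)
        then show "finite D" "card (fst ` D) = k" "fst ` D \<subseteq> {..<n}"
          using finite_subset[OF D(1)] by auto
      qed
      have s: "card J \<in> {1..r}" using J finJ by (auto simp: Suc_le_eq card_gt_0_iff)
      have "2 * card (cnf_vars J) \<le> k * card J + card (boundary J)"
        by (rule card_boundary_lower[OF finJ]) (use DJ in auto)
      then have "8 * card (cnf_vars J) \<le> (4 * k + 3) * card J"
        using J(4) by (simp add: algebra_simps)
      then have V: "card (cnf_vars J) \<le> h (card J)" by (simp add: h_def)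
      have Vn: "cnf_vars J \<subseteq> {..<n}" using DJ(3) unfolding cnf_vars_eq_UN by blast
      have "h (card J) \<le> k * r" using hle[of "card J"] J(3) by (meson le_trans mult_le_mono2)
      then have "h (card J) \<le> card {..<n}" using assms(2) by simp
      \<comment> \<open>Padding to exactly \<open>h (card J)\<close> variables makes a single
        binomial coefficient count the choices; \<open>k * r \<le> n\<close> leaves room for
        it.\<close>
      then obtain W where W: "cnf_vars J \<subseteq> W" "W \<subseteq> {..<n}" "card W = h (card J)"
        using exists_subset_between[OF V _ Vn] by auto
      obtain I where I: "I \<subseteq> {..<length F}" "card I = card J" "(!) F ` I = J"
        using set_subset_index_image[OF J(1)] .
      have "fst ` (F ! i) \<subseteq> W" if "i \<in> I" for i
        using that I(3) W(1) unfolding cnf_vars_eq_UN by blast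
      moreover have "I \<in> X (card J)" using I(1,2) ord(1) by (simp add: X_def)
      moreover have "W \<in> Y (card J)" using W by (simp add: Y_def)
      ultimately have "F \<in> E (card J)" unfolding E_def by blast
      then show ?thesis using s by blast
    qed
    then show "AE F in random_kcnf k n m. F \<in> {F. \<not> expanding r F} \<longrightarrow> F \<in> (\<Union>s\<in>{1..r}. E s)"
      by (simp add: AE_measure_pmf_iff)
  qed simp
  also have "\<dots> \<le> (\<Sum>s\<in>{1..r}. measure_pmf.prob (random_kcnf k n m) (E s))"
    by (rule measure_pmf.finite_measure_subadditive_finite) auto
  also have "\<dots> \<le> (\<Sum>s\<in>{1..r}. real (m choose s) * real (n choose h s) * (real (h s) / real n) ^ (k * s))"
  proof (rule sum_mono)
    fix s
    have "measure_pmf.prob (random_kcnf k n m) (E s)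
        \<le> real (card (X s)) * real (card (Y s)) * ((real (h s) / real n) ^ k) ^ s"
      unfolding E_def random_kcnf_def
    proof (rule prob_replicate_union_bound[OF fin])
      fix W assume "W \<in> Y s"
      then show "measure_pmf.prob (pmf_of_set (ordinary_clauses k n)) {C. fst ` C \<subseteq> W}
          \<le> (real (h s) / real n) ^ k"
        using prob_ordinary_subset_le[OF assms(1), of W] by (auto simp: Y_def)
    qed (auto simp: X_def)
    then show "measure_pmf.prob (random_kcnf k n m) (E s)
        \<le> real (m choose s) * real (n choose h s) * (real (h s) / real n) ^ (k * s)"
      by (simp add: card power_mult)
  qed
  finally show ?thesis by (simp add: h_def)
qed

text \<open>All \<open>U\<close> are covered at once because the set of high-degree variables, to
  which this is applied, depends on \<open>F\<close>.\<close>

definition touch_bounded :: "nat \<Rightarrow> nat \<Rightarrow> nat \<Rightarrow> nat clause list \<Rightarrow> bool" where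
  "touch_bounded n u h F \<longleftrightarrow>
     (\<forall>U\<subseteq>{..<n}. card U \<le> u \<longrightarrow> card {D \<in> set F. fst ` D \<inter> U \<noteq> {}} \<le> h)"

text \<open>Counting positions and sets \<open>U\<close> by powers of two is crude but affordable:
  the base \<open>k * u / n\<close> can be made an arbitrarily small constant while \<open>h\<close>
  stays linear in \<open>n\<close>.\<close>

lemma prob_not_touch_bounded_le:
  assumes "k \<le> n" "1 \<le> n"
  shows "measure_pmf.prob (random_kcnf k n m) {F. \<not> touch_bounded n u h F}
    \<le> 2 ^ m * 2 ^ n * (real k * real u / real n) ^ h"
proof -
  define X where "X = {I. I \<subseteq> {..<m} \<and> card I = h}"
  define Y where "Y = {U. U \<subseteq> {..<n} \<and> card U \<le> u}"
  define E where "E = {F :: nat clause list. \<exists>I\<in>X. \<exists>U\<in>Y. \<forall>i\<in>I. F ! i \<in> {C. fst ` C \<inter> U \<noteq> {}}}"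
  have fin: "finite X" "finite Y" by (auto simp: X_def Y_def)
  have "card X \<le> card (Pow {..<m})" "card Y \<le> card (Pow {..<n})"
    by (intro card_mono; auto simp: X_def Y_def)+
  then have card: "card X \<le> 2 ^ m" "card Y \<le> 2 ^ n" by (simp_all add: card_Pow)
  have "measure_pmf.prob (random_kcnf k n m) {F. \<not> touch_bounded n u h F}
      \<le> measure_pmf.prob (random_kcnf k n m) E"
  proof (rule measure_pmf.finite_measure_mono_AE)
    have "F \<in> E" if F: "F \<in> set_pmf (random_kcnf k n m)" "\<not> touch_bounded n u h F" for F
    proof -
      obtain U where U: "U \<subseteq> {..<n}" "card U \<le> u" "h < card {D \<in> set F. fst ` D \<inter> U \<noteq> {}}"
        using F(2) by (auto simp: touch_bounded_def not_le)
      then obtain J where J: "J \<subseteq> {D \<in> set F. fst ` D \<inter> U \<noteq> {}}" "card J = h"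
        using obtain_subset_with_card_n[OF less_imp_le[OF U(3)]] by blast
      have "J \<subseteq> set F" using J(1) by blast
      then obtain I where I: "I \<subseteq> {..<length F}" "card I = card J" "(!) F ` I = J"
        using set_subset_index_image[of J F] by blast
      have "fst ` (F ! i) \<inter> U \<noteq> {}" if "i \<in> I" for i using that I(3) J(1) by blast
      moreover have "I \<in> X" using I J set_random_kcnf(1)[OF assms(1) F(1)] by (simp add: X_def)
      moreover have "U \<in> Y" using U by (simp add: Y_def)
      ultimately show ?thesis unfolding E_def by blast
    qed
    then show "AE F in random_kcnf k n m. F \<in> {F. \<not> touch_bounded n u h F} \<longrightarrow> F \<in> E"
      by (simp add: AE_measure_pmf_iff)
  qed simp
  also have "\<dots> \<le> real (card X) * real (card Y) * (real k * real u / real n) ^ h"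
    unfolding E_def random_kcnf_def
  proof (rule prob_replicate_union_bound[OF fin])
    fix U assume U: "U \<in> Y"
    then have "measure_pmf.prob (pmf_of_set (ordinary_clauses k n)) {C. fst ` C \<inter> U \<noteq> {}}
        \<le> real k * real (card U) / real n"
      by (intro prob_ordinary_touch_le[OF assms]) (auto simp: Y_def)
    also have "\<dots> \<le> real k * real u / real n"
      using U by (intro divide_right_mono mult_left_mono) (auto simp: Y_def)
    finally show "measure_pmf.prob (pmf_of_set (ordinary_clauses k n)) {C. fst ` C \<inter> U \<noteq> {}}
        \<le> real k * real u / real n" .
  qed (auto simp: X_def)
  also have "\<dots> \<le> 2 ^ m * 2 ^ n * (real k * real u / real n) ^ h"
  proof (rule mult_right_mono)
    have "real (card X) \<le> 2 ^ m" "real (card Y) \<le> 2 ^ n"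
      using card by (simp_all flip: of_nat_le_iff)
    then show "real (card X) * real (card Y) \<le> 2 ^ m * 2 ^ n" by (intro mult_mono) auto
  qed simp
  finally show ?thesis .
qed

section \<open>Asymptotic estimates\<close>

lemma power_self_le_exp_fact: "real h ^ h \<le> exp (real h) * fact h"
proof -
  have "(\<Sum>i\<in>{h}. real h ^ i /\<^sub>R fact i) \<le> (\<Sum>i. real h ^ i /\<^sub>R fact i)"
    by (rule sum_le_suminf[OF summable_exp_generic]) auto
  then show ?thesis by (simp add: exp_def field_simps)
qed

text \<open>The estimate (n choose h) \<le> (e n / h)^h, multiplied out so that h = 0 is
  covered.\<close>

lemma binomial_mult_power_le: "real (n choose h) * real h ^ h \<le> (exp 1 * real n) ^ h"
proof -
  have "real (n choose h) * real h ^ h \<le> real (n choose h) * (exp (real h) * fact h)"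
    by (intro mult_left_mono power_self_le_exp_fact) simp
  also have "\<dots> = exp (real h) * real ((n choose h) * fact h)" by simp
  also have "\<dots> \<le> exp (real h) * real (n ^ h)"
    using binomial_fact_pow[of n h] by (intro mult_left_mono of_nat_mono) auto
  also have "\<dots> = (exp 1 * real n) ^ h"
    by (simp add: power_mult_distrib exp_of_nat_mult[of h 1, simplified])
  finally show ?thesis .
qed

text \<open>The \<open>k * s\<close> factors \<open>h / n\<close> are shared out: \<open>h\<close>
  of them absorb the choice of variables, \<open>s\<close> absorb the choice of clauses, and at
  least s/8 are left over to make the term small.\<close>

lemma expansion_term_le:
  fixes c :: real
  assumes s: "1 \<le> s" and n: "1 \<le> n" and m: "real m \<le> c * real n" and ks: "k * s \<le> n" and k: "3 \<le> k"
    and h: "h = (4 * k + 3) * s div 8"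
  shows "real (m choose s) * real (n choose h) * (real h / real n) ^ (k * s)
    \<le> (c * real k * exp (real k + 1) * (real k * real s / real n) powr (1 / 8)) ^ s"
proof -
  define u where "u = real k * real s / real n"
  have u: "0 < u" "u \<le> 1"
    using s n k ks by (auto simp: u_def simp flip: of_nat_mult)
  \<comment> \<open>Here k \<ge> 3 yields the spare factors: (4k + 3) + 9 \<le> 8k.\<close>
  have h8: "8 * h + 9 * s \<le> 8 * (k * s)"
  proof -
    have "8 * h \<le> (4 * k + 3) * s" by (simp add: h)
    moreover have "(4 * k + 3) * s + 9 * s \<le> 8 * (k * s)"
      using mult_le_mono1[OF k, of s] by (simp add: algebra_simps)
    ultimately show ?thesis by linarith
  qed
  define e where "e = k * s - h - s"
  have split: "k * s = h + (s + e)" and e: "s \<le> 8 * e" using h8 by (auto simp: e_def)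
  have hu: "real h / real n \<le> u"
    using split by (simp add: u_def divide_right_mono flip: of_nat_mult)
  have "0 \<le> c * real n" using m of_nat_0_le_iff[of m] by linarith
  then have c: "0 \<le> c" using n by (simp add: zero_le_mult_iff)
  have A: "real (m choose s) \<le> (exp 1 * c * real n / real s) ^ s"
  proof -
    have "real (m choose s) * real s ^ s \<le> (exp 1 * real m) ^ s" by (rule binomial_mult_power_le)
    also have "\<dots> \<le> (exp 1 * (c * real n)) ^ s" using m by (intro power_mono mult_left_mono) auto
    finally show ?thesis using s by (simp add: power_divide field_simps)
  qed
  have B: "real (n choose h) * (real h / real n) ^ h \<le> exp (real k) ^ s"
  proof -
    have "real (n choose h) * (real h / real n) ^ h = real (n choose h) * real h ^ h / real n ^ h"
      by (simp add: power_divide)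
    also have "\<dots> \<le> (exp 1 * real n) ^ h / real n ^ h"
      by (intro divide_right_mono binomial_mult_power_le) simp
    also have "\<dots> = exp 1 ^ h" using n by (simp add: power_mult_distrib)
    also have "\<dots> \<le> exp 1 ^ (k * s)" using split by (intro power_increasing) auto
    also have "\<dots> = exp (real k) ^ s"
      by (simp add: power_mult exp_of_nat_mult[of k 1, simplified])
    finally show ?thesis .
  qed
  have C: "(real h / real n) ^ (s + e) \<le> u ^ s * (u powr (1 / 8)) ^ s"
  proof -
    have "(real h / real n) ^ (s + e) \<le> u ^ (s + e)" using hu by (intro power_mono) auto
    also have "\<dots> = u ^ s * u powr real e" using u by (simp add: power_add powr_realpow)
    also have "\<dots> \<le> u ^ s * u powr (1 / 8 * real s)"
      using u e by (intro mult_left_mono powr_mono') auto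
    also have "\<dots> = u ^ s * (u powr (1 / 8)) ^ s"
      using u powr_powr[of u "1 / 8" "real s"] powr_realpow[of "u powr (1 / 8)" s] by simp
    finally show ?thesis .
  qed
  have "real (m choose s) * real (n choose h) * (real h / real n) ^ (k * s)
      = real (m choose s) * (real (n choose h) * (real h / real n) ^ h) * (real h / real n) ^ (s + e)"
    by (simp add: split power_add)
  also have "\<dots> \<le> (exp 1 * c * real n / real s) ^ s * exp (real k) ^ s * (u ^ s * (u powr (1 / 8)) ^ s)"
    using c by (intro mult_mono A B C) auto
  also have "\<dots> = (exp 1 * c * real n / real s * exp (real k) * (u * u powr (1 / 8))) ^ s"
    by (simp add: power_mult_distrib power_divide)
  also have "exp 1 * c * real n / real s * exp (real k) * (u * u powr (1 / 8))
      = c * real k * exp (real k + 1) * u powr (1 / 8)"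
  proof -
    have "real n / real s * u = real k" using s n by (simp add: u_def)
    moreover have "exp 1 * c * real n / real s * exp (real k) * (u * u powr (1 / 8))
        = c * (real n / real s * u) * (exp (real k) * exp 1) * u powr (1 / 8)" by simp
    ultimately show ?thesis by (simp add: exp_add)
  qed
  finally show ?thesis by (simp add: u_def)
qed

lemma sum_mult_half_power: "(\<Sum>s=1..r. real s * (1 / 2) ^ (s - 1)) = 4 - (2 * real r + 4) * (1 / 2) ^ r"
proof (induction r)
  case (Suc r)
  have "(\<Sum>s=1..Suc r. real s * (1 / 2) ^ (s - 1))
      = 4 - (2 * real r + 4) * (1 / 2) ^ r + real (Suc r) * (1 / 2 :: real) ^ r"
    using Suc by simp
  also have "\<dots> = 4 - (2 * real (Suc r) + 4) * (1 / 2) ^ Suc r" by (simp add: algebra_simps)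
  finally show ?case .
qed simp

text \<open>With y = B (k s / n)^(1/8) \<le> 1/2, the s-th term is at most y^s \<le> y (1/2)^(s -
  1), and y is at most s times its value at s = 1. So the sum is of order n^(-1/8), the small sets
  being the critical ones.\<close>

lemma expanding_whp:
  fixes c :: real
  assumes c: "0 < c" and k: "3 \<le> k"
  obtains \<delta> where "0 < \<delta>" "\<delta> \<le> 1"
    "(\<lambda>n. measure_pmf.prob (random_kcnf k n (nat \<lfloor>c * real n\<rfloor>))
        {F. \<not> expanding (nat \<lfloor>\<delta> * real n\<rfloor>) F}) \<longlonglongrightarrow> 0"
proof -
  define B where "B = c * real k * exp (real k + 1)"
  have B: "0 < B" using c k by (simp add: B_def)
  \<comment> \<open>\<open>B * z \<le> 1 / 2\<close> is the bound wanted for \<open>y\<close>; the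
    eighth power in \<open>\<delta>\<close> undoes the exponent 1/8.\<close>
  define z where "z = 1 / (2 * (B + 1))"
  have z: "0 < z" "z \<le> 1" "B * z \<le> 1 / 2" using B by (simp_all add: z_def field_simps)
  define \<delta> where "\<delta> = z ^ 8 / real k"
  have z8: "0 < z ^ 8" "z ^ 8 \<le> 1" using z by (auto intro: power_le_one)
  have \<delta>: "0 < \<delta>" "\<delta> \<le> 1" "real k * \<delta> = z ^ 8"
    using z8 k by (auto simp: \<delta>_def field_simps)
  have z8r: "(z ^ 8) powr (1 / 8) = z"
  proof -
    have "z ^ 8 = z powr 8" using z powr_realpow[of z 8] by simp
    then show ?thesis using z by (simp only: powr_powr) simp
  qed
  have bound: "measure_pmf.prob (random_kcnf k n (nat \<lfloor>c * real n\<rfloor>))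
        {F. \<not> expanding (nat \<lfloor>\<delta> * real n\<rfloor>) F} \<le> 4 * B * (real k / real n) powr (1 / 8)"
    if n: "k \<le> n" for n
  proof -
    define r where "r = nat \<lfloor>\<delta> * real n\<rfloor>"
    define m where "m = nat \<lfloor>c * real n\<rfloor>"
    have n1: "1 \<le> n" using n k by simp
    have r: "real r \<le> \<delta> * real n" using \<delta> by (simp add: r_def)
    have m: "real m \<le> c * real n" using c by (simp add: m_def)
    have kr: "real k * real r \<le> z ^ 8 * real n"
      using mult_left_mono[OF r, of "real k"] \<delta>(3) by (simp add: mult.assoc[symmetric])
    also have "\<dots> \<le> real n" using z8 by (simp add: mult_left_le_one_le)
    finally have krn: "k * r \<le> n" by (simp flip: of_nat_mult)
    have "measure_pmf.prob (random_kcnf k n m) {F. \<not> expanding r F}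
        \<le> (\<Sum>s=1..r. real (m choose s) * real (n choose ((4 * k + 3) * s div 8))
         * (real ((4 * k + 3) * s div 8) / real n) ^ (k * s))"
      by (rule prob_not_expanding_le[OF n krn k])
    also have "\<dots> \<le> (\<Sum>s=1..r. B * (real k / real n) powr (1 / 8) * (real s * (1 / 2) ^ (s - 1)))"
    proof (rule sum_mono)
      fix s assume s: "s \<in> {1..r}"
      define y where "y = B * (real k * real s / real n) powr (1 / 8)"
      have y0: "0 \<le> y" using B by (simp add: y_def)
      have ks: "k * s \<le> n" using s krn by (meson atLeastAtMost_iff le_trans mult_le_mono2)
      have "real k * real s \<le> z ^ 8 * real n"
        using kr s by (meson atLeastAtMost_iff le_trans mult_left_mono of_nat_0_le_iff of_nat_mono order_trans)
      then have "real k * real s / real n \<le> z ^ 8" using n1 by (simp add: field_simps)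
      then have "(real k * real s / real n) powr (1 / 8) \<le> z"
        using powr_mono2[of "1/8" "real k * real s / real n" "z ^ 8"] z8r by simp
      then have "y \<le> B * z" using B by (simp add: y_def)
      then have y: "y \<le> 1 / 2" using z(3) by linarith
      have "(real s) powr (1 / 8) \<le> real s powr 1" using s by (intro powr_mono) auto
      then have "(real s) powr (1 / 8) \<le> real s" using s by simp
      moreover have "(real k * real s / real n) powr (1 / 8) = (real k / real n) powr (1 / 8) * (real s) powr (1 / 8)"
        by (simp add: powr_mult[symmetric])
      ultimately have ys: "y \<le> B * (real k / real n) powr (1 / 8) * real s"
        using B by (simp add: y_def mult.assoc mult_left_mono)
      have "real (m choose s) * real (n choose ((4 * k + 3) * s div 8))
         * (real ((4 * k + 3) * s div 8) / real n) ^ (k * s) \<le> y ^ s"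
        unfolding y_def B_def by (rule expansion_term_le[OF _ n1 m ks k refl]) (use s in auto)
      also have "\<dots> = y * y ^ (s - 1)" using s by (cases s) auto
      also have "\<dots> \<le> (B * (real k / real n) powr (1 / 8) * real s) * (1 / 2) ^ (s - 1)"
        using y0 y ys B by (intro mult_mono power_mono) auto
      finally show "real (m choose s) * real (n choose ((4 * k + 3) * s div 8))
         * (real ((4 * k + 3) * s div 8) / real n) ^ (k * s)
         \<le> B * (real k / real n) powr (1 / 8) * (real s * (1 / 2) ^ (s - 1))" by (simp add: mult.assoc)
    qed
    also have "\<dots> = B * (real k / real n) powr (1 / 8) * (\<Sum>s=1..r. real s * (1 / 2) ^ (s - 1))"
      by (simp add: sum_distrib_left)
    also have "\<dots> \<le> B * (real k / real n) powr (1 / 8) * 4"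
      using B unfolding sum_mult_half_power by (intro mult_left_mono) auto
    finally show ?thesis by (simp add: r_def m_def mult_ac)
  qed
  have lim: "(\<lambda>n. 4 * B * (real k / real n) powr (1 / 8)) \<longlonglongrightarrow> 0"
  proof -
    have "(\<lambda>n. (real k / real n) powr (1 / 8)) \<longlonglongrightarrow> 0"
      by (rule tendsto_zero_powrI[OF _ tendsto_const])
         (use tendsto_divide_0[OF tendsto_const filterlim_real_sequentially[THEN filterlim_at_top_imp_at_infinity]] in auto)
    then show ?thesis by (rule tendsto_mult_right_zero)
  qed
  have "(\<lambda>n. measure_pmf.prob (random_kcnf k n (nat \<lfloor>c * real n\<rfloor>))
        {F. \<not> expanding (nat \<lfloor>\<delta> * real n\<rfloor>) F}) \<longlonglongrightarrow> 0"
    by (rule tendsto_sandwich[OF _ _ tendsto_const lim])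
       (use bound in \<open>auto intro: eventually_sequentiallyI[of k]\<close>)
  then show thesis using that \<delta> by blast
qed

lemma touch_bounded_whp:
  fixes c \<theta> :: real
  assumes c: "0 < c" and k: "3 \<le> k" and \<theta>: "0 < \<theta>"
  obtains \<sigma> where "0 < \<sigma>"
    "(\<lambda>n. measure_pmf.prob (random_kcnf k n (nat \<lfloor>c * real n\<rfloor>))
        {F. \<not> touch_bounded n (nat \<lfloor>\<sigma> * real n\<rfloor>) (nat \<lfloor>\<theta> * real n\<rfloor>) F}) \<longlonglongrightarrow> 0"
proof -
  \<comment> \<open>With \<open>h\<close> about \<open>\<theta> * n\<close>, \<open>z ^ h\<close> is
    about 2^(-(c + 2) n), against at most 2^(c n + n) choices.\<close>
  define z :: real where "z = 2 powr (- (c + 2) / \<theta>)"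
  have "(2 :: real) powr (- (c + 2) / \<theta>) \<le> 2 powr 0"
    using c \<theta> by (intro powr_mono) (auto simp: field_simps)
  then have z: "0 < z" "z \<le> 1" by (auto simp: z_def)
  define \<sigma> where "\<sigma> = z / real k"
  have \<sigma>: "0 < \<sigma>" "real k * \<sigma> = z" using z k by (auto simp: \<sigma>_def)
  have bound: "measure_pmf.prob (random_kcnf k n (nat \<lfloor>c * real n\<rfloor>))
        {F. \<not> touch_bounded n (nat \<lfloor>\<sigma> * real n\<rfloor>) (nat \<lfloor>\<theta> * real n\<rfloor>) F} \<le> (1 / z) * (1 / 2) ^ n"
    if n: "k \<le> n" for n
  proof -
    define u h m where "u = nat \<lfloor>\<sigma> * real n\<rfloor>" and "h = nat \<lfloor>\<theta> * real n\<rfloor>" and "m = nat \<lfloor>c * real n\<rfloor>"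
    have n1: "1 \<le> n" using n k by simp
    have u: "real u \<le> \<sigma> * real n" using \<sigma> by (simp add: u_def)
    have m: "real m \<le> c * real n" using c by (simp add: m_def)
    have h: "\<theta> * real n - 1 \<le> real h" unfolding h_def by linarith
    have "real k * real u \<le> z * real n"
      using mult_left_mono[OF u, of "real k"] \<sigma>(2) by (simp add: mult.assoc[symmetric])
    then have q: "real k * real u / real n \<le> z" using n1 by (simp add: field_simps)
    have "measure_pmf.prob (random_kcnf k n m) {F. \<not> touch_bounded n u h F}
        \<le> 2 ^ m * 2 ^ n * (real k * real u / real n) ^ h"
      by (rule prob_not_touch_bounded_le[OF n n1])
    also have "\<dots> \<le> 2 powr (c * real n) * 2 powr (real n) * z powr (\<theta> * real n - 1)"
    proof (intro mult_mono)
      show "(2 :: real) ^ m \<le> 2 powr (c * real n)" using m by (simp flip: powr_realpow)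
      show "(2 :: real) ^ n \<le> 2 powr (real n)" by (simp add: powr_realpow)
      have "(real k * real u / real n) ^ h \<le> z ^ h" using q by (intro power_mono) auto
      also have "\<dots> = z powr real h" using z by (simp add: powr_realpow)
      also have "\<dots> \<le> z powr (\<theta> * real n - 1)" using z h by (intro powr_mono') auto
      finally show "(real k * real u / real n) ^ h \<le> z powr (\<theta> * real n - 1)" .
    qed auto
    also have "z powr (\<theta> * real n - 1) = 2 powr (- (c + 2) * real n) / z"
    proof -
      have "z powr (\<theta> * real n) = 2 powr (- (c + 2) * real n)"
        using \<theta> by (simp add: z_def powr_powr)
      then show ?thesis using z by (simp add: powr_diff)
    qed
    also have "2 powr (c * real n) * 2 powr (real n) * (2 powr (- (c + 2) * real n) / z)
        = (1 / z) * 2 powr (c * real n + real n + - (c + 2) * real n)"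
      by (simp add: powr_add)
    also have "c * real n + real n + - (c + 2) * real n = - real n" by (simp add: algebra_simps)
    also have "2 powr (- real n) = (1 / 2) ^ n"
      by (simp add: powr_minus powr_realpow power_one_over inverse_eq_divide)
    finally show ?thesis by (simp add: u_def h_def m_def)
  qed
  have lim: "(\<lambda>n. (1 / z) * (1 / 2) ^ n) \<longlonglongrightarrow> 0"
    by (intro tendsto_mult_right_zero LIMSEQ_power_zero) simp
  have "(\<lambda>n. measure_pmf.prob (random_kcnf k n (nat \<lfloor>c * real n\<rfloor>))
        {F. \<not> touch_bounded n (nat \<lfloor>\<sigma> * real n\<rfloor>) (nat \<lfloor>\<theta> * real n\<rfloor>) F}) \<longlonglongrightarrow> 0"
    by (rule tendsto_sandwich[OF _ _ tendsto_const lim])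
       (use bound in \<open>auto intro: eventually_sequentiallyI[of k]\<close>)
  then show thesis using that \<sigma> by blast
qed

section \<open>Choice of constants and conclusion\<close>

lemma random_refutation_mono:
  assumes "random_refutation D H \<epsilon> w" "\<epsilon> \<le> \<epsilon>'" "w \<le> w'"
  shows "random_refutation D H \<epsilon>' w'"
  unfolding random_refutation_def
proof (intro conjI allI)
  show "\<forall>(P, B)\<in>set_pmf D. (\<forall>C\<in>B. fst ` C \<subseteq> cnf_vars H) \<and> is_refutation (H \<union> B) P \<and> real (ref_width P) \<le> w'"
    using assms(1,3) unfolding random_refutation_def by (smt (verit, best) case_prod_beta)
  show "1 - \<epsilon>' \<le> measure_pmf.prob D {(P, B). sat_cnf \<alpha> B}" for \<alpha>
  proof -
    have "1 - \<epsilon> \<le> measure_pmf.prob D {(P, B). sat_cnf \<alpha> B}"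
      using assms(1) unfolding random_refutation_def by blast
    then show ?thesis using assms(2) by linarith
  qed
qed

lemma random_refutation_of_good:
  assumes ord: "set F \<subseteq> ordinary_clauses k n" "length F \<le> m" and k: "3 \<le> k"
    and exp: "expanding r F" and touch: "touch_bounded n u h F"
    and u: "k * m \<le> u * \<Delta>" and K: "K = 1 + \<Delta> * (k * (\<Delta> * k))"
    and L: "1 \<le> L" "L \<le> 2 ^ n"
    and r: "1 \<le> r" "8 * w + 8 * t \<le> 3 * r"
    and q: "1 \<le> q" "q + t * K + h * k \<le> w" "w \<le> n"
  shows "\<exists>D. random_refutation D (sLB F n L) (real L * (1 - real q / (2 * real n)) ^ t)
    (real (9 * n + 1))"
proof -
  have D: "D \<subseteq> {..<n} \<times> UNIV \<and> card (fst ` D) = k" if "D \<in> set F" for D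
    using that ord(1) by (auto simp: ordinary_clauses_def)
  have D': "finite D \<and> fst ` D \<subseteq> {..<n} \<and> card (fst ` D) \<le> k" if "D \<in> set F" for D
    using D[OF that] finite_subset[of D "{..<n} \<times> UNIV"] by auto
  have "card (set F) \<le> m" using card_length[of F] ord(2) by linarith
  then obtain A where A: "A \<subseteq> {..<n}" "card ({..<n} - A) \<le> h * k"
    "\<And>x. x \<in> A \<Longrightarrow> finite (conflict (set F) x) \<and> card (conflict (set F) x) \<le> K"
    using few_conflicts[of "set F" m n k u h \<Delta>] D' touch u K unfolding touch_bounded_def by auto
  show ?thesis
    by (rule random_refutation_of_expansion[OF D k L _ A(1,3) _ r q(1) _ q(3)])
       (use exp A(2) q(2) K in \<open>auto simp: expanding_def\<close>)
qed

text \<open>Put \<open>\<eta> = d * g / 512\<close>. A draw misses with probability at most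
  exp(-d/128), so g n / 2 draws give exp(-2 \<open>\<eta>\<close> n), of which the factor
  \<open>L\<close> consumes only half the exponent.\<close>

lemma failure_bound:
  fixes d g :: real
  assumes n: "1 \<le> n" and d: "0 < d" "d \<le> 1" and g: "0 < g"
    and q: "d * real n / 64 \<le> real q" "real q \<le> real n" and t: "g * real n / 2 \<le> real t"
    and L: "real L \<le> (1 + d * g / 512) ^ n"
  shows "real L * (1 - real q / (2 * real n)) ^ t \<le> 2 powr (- (d * g / 512) * real n)"
proof -
  define \<eta> where "\<eta> = d * g / 512"
  have \<eta>: "0 < \<eta>" using d g by (simp add: \<eta>_def)
  have "1 + \<eta> \<le> exp \<eta>" by (rule exp_ge_add_one_self)
  then have "(1 + \<eta>) ^ n \<le> exp \<eta> ^ n" using \<eta> by (intro power_mono) auto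
  then have L': "real L \<le> exp (\<eta> * real n)"
    using L by (simp add: \<eta>_def[symmetric] exp_of_nat_mult[symmetric] mult.commute)
  have "d / 128 \<le> real q / (2 * real n)" using n q(1) by (simp add: field_simps)
  then have "1 - real q / (2 * real n) \<le> 1 + (- (d / 128))" by simp
  also have "\<dots> \<le> exp (- (d / 128))" by (rule exp_ge_add_one_self)
  finally have "1 - real q / (2 * real n) \<le> exp (- (d / 128))" .
  moreover have "0 \<le> 1 - real q / (2 * real n)" using q(2) n by (simp add: field_simps)
  ultimately have "(1 - real q / (2 * real n)) ^ t \<le> exp (- (d / 128)) ^ t" by (intro power_mono)
  also have "\<dots> = exp (real t * - (d / 128))" by (rule exp_of_nat_mult[symmetric])
  also have "\<dots> \<le> exp (- 2 * \<eta> * real n)"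
    using mult_right_mono[OF t, of "d / 128"] d by (simp add: \<eta>_def algebra_simps)
  finally have "real L * (1 - real q / (2 * real n)) ^ t \<le> exp (\<eta> * real n) * exp (- 2 * \<eta> * real n)"
    using L' q(2) n by (intro mult_mono zero_le_power) (auto simp: field_simps)
  also have "\<dots> = exp (- (\<eta> * real n))" by (simp flip: exp_add)
  also have "\<dots> \<le> exp (- (\<eta> * real n) * ln 2)"
    using \<eta> ln_2_less_1 by (simp add: mult_left_le)
  also have "\<dots> = 2 powr (- \<eta> * real n)" by (simp add: powr_def)
  finally show ?thesis by (simp add: \<eta>_def)
qed

text \<open>The type of \<open>\<epsilon>\<close> in \<open>theorem6p3\<close> is not forced to be \<open>real\<close> but is an arbitrary floor field; this lemma
  makes the bound on the proof size independent of it.\<close>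

lemma floor_one_plus_inverse_power:
  assumes "0 < N"
  shows "\<lfloor>(1 + 1 / of_nat N :: 'a :: floor_ceiling) ^ n\<rfloor> = int (Suc N ^ n div N ^ n)"
proof -
  have "(1 + 1 / of_nat N :: 'a) = of_nat (Suc N) / of_nat N" using assms by (simp add: field_simps)
  then have "(1 + 1 / of_nat N :: 'a) ^ n = of_nat (Suc N ^ n) / of_nat (N ^ n)"
    by (simp only: power_divide of_nat_power)
  then show ?thesis by (simp only: floor_divide_of_nat_eq)
qed

theorem theorem6p3:
  fixes k :: nat and c :: real
  assumes "k \<ge> 3" and "c \<ge> 0.7 * 2 ^ k"
  shows "\<exists>\<epsilon>>0. \<exists>(a::real) (d::nat) (\<delta>::real). \<delta> > 0 \<and>
    (\<lambda>n. measure_pmf.prob (random_kcnf k n (nat \<lfloor>c * real n\<rfloor>))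
        {F. \<exists>D. random_refutation D (sLB F n (nat \<lfloor>(1 + \<epsilon>) ^ n\<rfloor>))
                  (2 powr (- \<delta> * real n)) (a * real n ^ d)})
    \<longlonglongrightarrow> 1"
proof -
  have "(0 :: real) < 0.7 * 2 ^ k" by simp
  then have c: "0 < c" using assms(2) by linarith
  obtain d :: real where d: "0 < d" "d \<le> 1" and exp_lim:
    "(\<lambda>n. measure_pmf.prob (random_kcnf k n (nat \<lfloor>c * real n\<rfloor>))
        {F. \<not> expanding (nat \<lfloor>d * real n\<rfloor>) F}) \<longlonglongrightarrow> 0" (is "?p1 \<longlonglongrightarrow> 0")
    using expanding_whp[OF c assms(1)] .
  \<comment> \<open>The budget \<open>w\<close> is about d n / 4. Discarded variables take d n / 16,
    deletions during the draws d n / 32, and \<open>q\<close> another d n / 32; the remainder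
    absorbs rounding.\<close>
  define \<theta> where "\<theta> = d / (16 * real k)"
  have \<theta>: "0 < \<theta>" "\<theta> * real k = d / 16" using d assms(1) by (auto simp: \<theta>_def)
  obtain \<sigma> :: real where \<sigma>: "0 < \<sigma>" and touch_lim:
    "(\<lambda>n. measure_pmf.prob (random_kcnf k n (nat \<lfloor>c * real n\<rfloor>))
        {F. \<not> touch_bounded n (nat \<lfloor>\<sigma> * real n\<rfloor>) (nat \<lfloor>\<theta> * real n\<rfloor>) F}) \<longlonglongrightarrow> 0" (is "?p2 \<longlonglongrightarrow> 0")
    using touch_bounded_whp[OF c assms(1) \<theta>(1)] .
  \<comment> \<open>Ensures \<open>k * m \<le> u * \<Delta>\<close> even if rounding halves
    \<open>u\<close>.\<close>
  define \<Delta> where "\<Delta> = nat \<lceil>2 * real k * c / \<sigma>\<rceil>"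
  define K where "K = 1 + \<Delta> * (k * (\<Delta> * k))"
  have K: "1 \<le> real K" by (simp add: K_def)
  define g where "g = d / (32 * real K)"
  have g: "0 < g" "g * real K = d / 32" "g \<le> d / 32"
    using d K by (auto simp: g_def field_simps)
  define \<eta> where "\<eta> = d * g / 512"
  have "d * g \<le> 1 * 1" using d g by (intro mult_mono) auto
  then have \<eta>: "0 < \<eta>" "\<eta> \<le> 1" using d g by (auto simp: \<eta>_def)
  define N where "N = nat \<lceil>1 / \<eta>\<rceil>"
  have "1 / \<eta> \<le> real N" unfolding N_def by linarith
  moreover have "0 < 1 / \<eta>" using \<eta> by simp
  ultimately have "0 < real N" by linarith
  then have N: "0 < N" "1 / real N \<le> \<eta>" using \<open>1 / \<eta> \<le> real N\<close> \<eta> by (auto simp: field_simps)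
  define good where "good n = {F. \<exists>D. random_refutation D (sLB F n (nat \<lfloor>(1 + 1 / real N) ^ n\<rfloor>))
      (2 powr (- \<eta> * real n)) (10 * real n ^ 1)}" for n
  \<comment> \<open>The thresholds on \<open>n\<close> ensure that rounding down costs
    \<open>u\<close>, \<open>q\<close> and \<open>t\<close> at most half of their values.\<close>
  have ev: "1 - (?p1 n + ?p2 n) \<le> measure_pmf.prob (random_kcnf k n (nat \<lfloor>c * real n\<rfloor>)) (good n)"
    if large: "k \<le> n" "2 \<le> \<sigma> * real n" "64 \<le> d * real n" "2 \<le> g * real n" for n
  proof -
    define m r u h t q L where "m = nat \<lfloor>c * real n\<rfloor>" and "r = nat \<lfloor>d * real n\<rfloor>"
      and "u = nat \<lfloor>\<sigma> * real n\<rfloor>" and "h = nat \<lfloor>\<theta> * real n\<rfloor>" and "t = nat \<lfloor>g * real n\<rfloor>"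
      and "q = nat \<lfloor>d * real n / 32\<rfloor>" and "L = nat \<lfloor>(1 + 1 / real N) ^ n\<rfloor>"
    \<comment> \<open>Of the boundary \<open>3 * r / 8\<close> of a medium set, \<open>r / 4\<close>
      is required as width, and \<open>r / 8\<close> pays for the variables fixed by
      \<open>\<rho>\<close>.\<close>
    define w where "w = r div 4"
    have n: "1 \<le> n" using large(1) assms(1) by simp
    have m: "real m \<le> c * real n" using c by (simp add: m_def)
    have r: "d * real n - 1 \<le> real r" unfolding r_def by linarith
    have r': "real r \<le> d * real n" using d by (simp add: r_def)
    have u: "\<sigma> * real n / 2 \<le> real u" using large(2) unfolding u_def by linarith
    have h: "real h \<le> \<theta> * real n" using \<theta> by (simp add: h_def)
    have "g * real n - 1 \<le> real t" unfolding t_def by linarith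
    then have t: "g * real n / 2 \<le> real t" using large(4) by linarith
    have t': "real t \<le> g * real n" using g by (simp add: t_def)
    have "d * real n / 32 - 1 \<le> real q" unfolding q_def by linarith
    then have q: "d * real n / 64 \<le> real q" using large(3) by linarith
    have q': "real q \<le> d * real n / 32" unfolding q_def using d by (intro of_nat_floor) simp
    have dn: "d * real n \<le> real n" using d by (simp add: mult_left_le_one_le)
    have \<Delta>: "2 * real k * c / \<sigma> \<le> real \<Delta>" unfolding \<Delta>_def by linarith
    have "real k * real m \<le> real k * (c * real n)" using m by (intro mult_left_mono) auto
    also have "\<dots> = (\<sigma> * real n / 2) * (2 * real k * c / \<sigma>)" using \<sigma> by simp
    also have "\<dots> \<le> real u * real \<Delta>" using u \<Delta> \<sigma> c by (intro mult_mono) auto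
    finally have u\<Delta>: "k * m \<le> u * \<Delta>" by (simp flip: of_nat_mult)
    have ge1: "1 \<le> (1 + 1 / real N) ^ n" by (intro one_le_power) simp
    have "real L \<le> (1 + 1 / real N) ^ n" unfolding L_def by (rule of_nat_floor) (use ge1 in linarith)
    also have "\<dots> \<le> (1 + \<eta>) ^ n" using N by (intro power_mono) auto
    finally have L1: "1 \<le> L" "real L \<le> (1 + \<eta>) ^ n" using ge1 by (auto simp: L_def le_nat_floor)
    have "(1 + \<eta>) ^ n \<le> 2 ^ n" using \<eta> by (intro power_mono) auto
    with L1(2) have "real L \<le> 2 ^ n" by linarith
    then have L2: "L \<le> 2 ^ n" by simp
    have w: "4 * w \<le> r" "r \<le> 4 * w + 3" by (simp_all add: w_def)
    have tK: "real (t * K) \<le> d * real n / 32"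
    proof -
      have "real (t * K) \<le> g * real n * real K" using t' by (simp add: mult_right_mono)
      also have "\<dots> = g * real K * real n" by simp
      finally show ?thesis unfolding g(2) by simp
    qed
    have hk: "real (h * k) \<le> d * real n / 16"
    proof -
      have "real (h * k) \<le> \<theta> * real n * real k" using h by (simp add: mult_right_mono)
      also have "\<dots> = \<theta> * real k * real n" by simp
      finally show ?thesis unfolding \<theta>(2) by simp
    qed
    have "real r \<le> 4 * real w + 3" using w(2) by linarith
    then have "real (q + t * K + h * k) \<le> real w"
      using q' tK hk r large(3) unfolding of_nat_add by linarith
    then have qw: "q + t * K + h * k \<le> w" by (simp only: of_nat_le_iff)
    have "g * real n \<le> d * real n / 32" using mult_right_mono[OF g(3), of "real n"] by simp
    then have "8 * real t \<le> real r" using t' r large(3) by linarith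
    then have rt: "8 * w + 8 * t \<le> 3 * r" using w(1) by linarith
    have "real q \<ge> 1" using q large(3) by linarith
    then have q1: "1 \<le> q" by simp
    have r1: "1 \<le> r" using r large(3) by linarith
    have wn: "w \<le> n" using w(1) r' dn by linarith
    have fb: "real L * (1 - real q / (2 * real n)) ^ t \<le> 2 powr (- \<eta> * real n)"
      unfolding \<eta>_def
      by (rule failure_bound[OF n d g(1) q _ t L1(2)[unfolded \<eta>_def]])
         (use q' dn in linarith)
    have wb: "real (9 * n + 1) \<le> 10 * real n ^ 1" using n by simp
    have F: "F \<in> good n" if F0: "F \<in> set_pmf (random_kcnf k n m)" "expanding r F" "touch_bounded n u h F" for F
    proof -
      have "length F \<le> m" "set F \<subseteq> ordinary_clauses k n"
        using set_random_kcnf[OF large(1) F0(1)] by auto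
      then obtain D where "random_refutation D (sLB F n L) (real L * (1 - real q / (2 * real n)) ^ t)
          (real (9 * n + 1))"
        using random_refutation_of_good[OF _ _ assms(1) F0(2,3) u\<Delta> K_def L1(1) L2 r1 rt q1 qw wn]
        by blast
      then show ?thesis
        using random_refutation_mono[OF _ fb wb] unfolding good_def L_def by blast
    qed
    let ?M = "random_kcnf k n m"
    have "measure_pmf.prob ?M (- good n)
        \<le> measure_pmf.prob ?M ({F. \<not> expanding r F} \<union> {F. \<not> touch_bounded n u h F})"
      by (rule measure_pmf.finite_measure_mono_AE) (use F in \<open>auto simp: AE_measure_pmf_iff\<close>)
    also have "\<dots> \<le> measure_pmf.prob ?M {F. \<not> expanding r F}
        + measure_pmf.prob ?M {F. \<not> touch_bounded n u h F}"
      by (rule measure_Un_le) simp_all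
    finally show ?thesis
      using measure_pmf.prob_compl[of "good n" ?M]
      by (simp add: Compl_eq_Diff_UNIV m_def r_def u_def h_def)
  qed
  have lin: "\<forall>\<^sub>F n in sequentially. b \<le> x * real n" if "0 < x" for x b :: real
    using filterlim_tendsto_pos_mult_at_top[OF tendsto_const that filterlim_real_sequentially]
    by (simp add: filterlim_at_top)
  have ev: "\<forall>\<^sub>F n in sequentially. 1 - (?p1 n + ?p2 n)
      \<le> measure_pmf.prob (random_kcnf k n (nat \<lfloor>c * real n\<rfloor>)) (good n)"
    using eventually_ge_at_top[of k] lin[OF \<sigma>, of 2] lin[OF d(1), of 64] lin[OF g(1), of 2]
    by eventually_elim (rule ev)
  have lim: "(\<lambda>n. 1 - (?p1 n + ?p2 n)) \<longlonglongrightarrow> 1"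
    using tendsto_diff[OF tendsto_const tendsto_add[OF exp_lim touch_lim], of 1] by simp
  have good_lim: "(\<lambda>n. measure_pmf.prob (random_kcnf k n (nat \<lfloor>c * real n\<rfloor>)) (good n)) \<longlonglongrightarrow> 1"
    by (rule tendsto_sandwich[OF ev _ lim tendsto_const]) simp
  have fl: "\<lfloor>(1 + 1 / of_nat N :: 'a) ^ n\<rfloor> = \<lfloor>(1 + 1 / real N) ^ n\<rfloor>" for n
    using floor_one_plus_inverse_power[OF N(1)] by metis
  have pos: "0 < (1 / of_nat N :: 'a)" using N(1) by simp
  show ?thesis
    by (rule exI[of _ "1 / of_nat N"], rule conjI[OF pos], rule exI[of _ 10], rule exI[of _ 1],
        rule exI[of _ \<eta>], rule conjI[OF \<eta>(1)], rule good_lim[unfolded good_def, folded fl])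
qed

end
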